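(* Let $\beta>2$ and $\gamma<1/3$, and let $n=n_m$ be a sequence of positive integers such that $m^\beta\le n_m\le e^{m^\gamma}$ for all sufficiently large $m$. Then, for any $t>0$, $$\lim_{m\to\infty}\mathbf{P}\big(\widetilde{\mathcal{M}}^{(n_m)}_m\le t\big)=\exp\Big(-\frac{1}{t\,\zeta(2)}\Big),$$ so that $\widetilde{\mathcal{M}}^{(n_m)}_m$ tends in distribution, as $m\to\infty$, to the Fréchet distribution with shape parameter $1$ and scale parameter $1/\zeta(2)$.
   Context: For each integer $n\ge1$, $X^{(n)}_1,X^{(n)}_2,\ldots$ is a sequence of independent random variables uniformly distributed in $\{1,\ldots,n\}$, defined on a probability space with probability $\mathbf{P}$. For $m\ge2$, $$\mathcal{M}^{(n)}_m=\max_{1\le i<j\le m}\gcd(X^{(n)}_i,X^{(n)}_j),\qquad \widetilde{\mathcal{M}}^{(n)}_m=\binom{m}{2}^{-1}\mathcal{M}^{(n)}_m .$$ $\zeta$ is the Riemann zeta function. The Fréchet distribution with shape parameter $1$ and scale parameter $c>0$ is the one with distribution function $t\mapsto e^{-c/t}$ for $t>0$ (and $0$ for $t\le0$). *)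

theory Defs
  imports "HOL-Probability.Probability" "HOL-Real_Asymp.Real_Asymp"
begin

text \<open>The Dirichlet series of the zeta function, meaningful for real arguments \<open>s > 1\<close>.\<close>

definition zeta :: "real \<Rightarrow> real" where
  "zeta s = (\<Sum>k. 1 / real (Suc k) powr s)"

lemma summable_zeta:
  assumes "s > 1"
  shows "summable (\<lambda>k. 1 / real (Suc k) powr s)"
proof -
  have "summable (\<lambda>k. real k powr (- s))"
    using assms by (subst summable_real_powr_iff) auto
  hence "summable (\<lambda>k. real (Suc k) powr (- s))"
    by (subst summable_Suc_iff)
  thus ?thesis
    by (simp add: powr_minus divide_inverse del: of_nat_Suc)
qed

text \<open>The sequence is indexed from 1 on, so \<open>X 0\<close> plays no role. For \<open>m \<le> 1\<close> the set below
  is empty and the value of its maximum is unspecified.\<close>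

definition max_gcd :: "(nat \<Rightarrow> 'a \<Rightarrow> nat) \<Rightarrow> nat \<Rightarrow> 'a \<Rightarrow> nat" where
  "max_gcd X m \<omega> = Max {gcd (X i \<omega>) (X j \<omega>) | i j. 1 \<le> i \<and> i < j \<and> j \<le> m}"

definition scaled_max_gcd :: "(nat \<Rightarrow> 'a \<Rightarrow> nat) \<Rightarrow> nat \<Rightarrow> 'a \<Rightarrow> real" where
  "scaled_max_gcd X m \<omega> = real (max_gcd X m \<omega>) / real (m choose 2)"

text \<open>The Frechet distribution with shape parameter 1 and scale parameter \<open>c > 0\<close>.\<close>

definition frechet_cdf :: "real \<Rightarrow> real \<Rightarrow> real" where
  "frechet_cdf c t = (if t > 0 then exp (- c / t) else 0)"

definition frechet_distribution :: "real \<Rightarrow> real measure" where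
  "frechet_distribution c = interval_measure (frechet_cdf c)"

lemma frechet_cdf_mono:
  assumes "c > 0" "x \<le> y"
  shows "frechet_cdf c x \<le> frechet_cdf c y"
  using assms by (auto simp: frechet_cdf_def intro!: divide_left_mono)

lemma tendsto_frechet_at_right_0:
  assumes "c > 0"
  shows "((\<lambda>t. exp (- c / t)) \<longlongrightarrow> 0) (at_right (0::real))"
  using assms by real_asymp

lemma frechet_cdf_right_cont:
  assumes "c > 0"
  shows "continuous (at_right a) (frechet_cdf c)"
proof -
  consider "a < 0" | "a = 0" | "a > 0" by linarith
  then show ?thesis
  proof cases
    case 1
    have "eventually (\<lambda>t. t \<in> {a<..<0}) (at_right a)"
      using eventually_at_right_real[of a 0] 1 by auto
    hence "eventually (\<lambda>t. frechet_cdf c t = 0) (at_right a)"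
      by eventually_elim (auto simp: frechet_cdf_def)
    hence "(frechet_cdf c \<longlongrightarrow> 0) (at_right a)"
      by (rule tendsto_eventually)
    thus ?thesis using 1 by (simp add: continuous_within frechet_cdf_def)
  next
    case 2
    have "eventually (\<lambda>t. t \<in> {0<..<1::real}) (at_right 0)"
      using eventually_at_right_real[of 0 1] by auto
    hence "eventually (\<lambda>t. exp (- c / t) = frechet_cdf c t) (at_right 0)"
      by eventually_elim (auto simp: frechet_cdf_def)
    hence "(frechet_cdf c \<longlongrightarrow> 0) (at_right 0)"
      using tendsto_frechet_at_right_0[OF assms] by (rule Lim_transform_eventually[rotated])
    thus ?thesis using 2 by (simp add: continuous_within frechet_cdf_def)
  next
    case 3
    have "eventually (\<lambda>t. t \<in> {a<..<a+1}) (at_right a)"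
      using eventually_at_right_real[of a "a + 1"] by auto
    hence "eventually (\<lambda>t. exp (- c / t) = frechet_cdf c t) (at_right a)"
      by eventually_elim (use 3 in \<open>auto simp: frechet_cdf_def\<close>)
    moreover have "((\<lambda>t. exp (- c / t)) \<longlongrightarrow> exp (- c / a)) (at_right a)"
      using 3 by (intro tendsto_intros) auto
    ultimately have "(frechet_cdf c \<longlongrightarrow> exp (- c / a)) (at_right a)"
      by (rule Lim_transform_eventually[rotated])
    thus ?thesis using 3 by (simp add: continuous_within frechet_cdf_def)
  qed
qed

lemma frechet_cdf_at_bot: "(frechet_cdf c \<longlongrightarrow> 0) at_bot"
proof (rule tendsto_eventually)
  show "eventually (\<lambda>t. frechet_cdf c t = 0) at_bot"
    using eventually_le_at_bot[of "0::real"] by eventually_elim (auto simp: frechet_cdf_def)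
qed

lemma frechet_cdf_at_top: "(frechet_cdf c \<longlongrightarrow> 1) at_top"
proof -
  have "((\<lambda>t. exp (- c / t)) \<longlongrightarrow> 1) at_top"
    by real_asymp
  moreover have "eventually (\<lambda>t. exp (- c / t) = frechet_cdf c t) at_top"
    using eventually_gt_at_top[of "0::real"] by eventually_elim (auto simp: frechet_cdf_def)
  ultimately show ?thesis
    by (rule Lim_transform_eventually)
qed

lemma real_distribution_frechet:
  assumes "c > 0"
  shows "real_distribution (frechet_distribution c)"
  unfolding frechet_distribution_def
  by (rule real_distribution_interval_measure)
     (simp_all add: assms frechet_cdf_mono frechet_cdf_right_cont
        frechet_cdf_at_bot frechet_cdf_at_top)

lemma cdf_frechet:
  assumes "c > 0"
  shows "cdf (frechet_distribution c) = frechet_cdf c"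
  unfolding frechet_distribution_def
  by (rule cdf_interval_measure)
     (simp_all add: assms frechet_cdf_mono frechet_cdf_right_cont
        frechet_cdf_at_bot frechet_cdf_at_top)

end

theory Submission
  imports Defs
begin

text \<open>
  Among \<open>m\<close> independent uniform variables on \<open>{1..N}\<close> there are \<open>m choose 2\<close> pairs, and the
  maximal gcd is at most \<open>K\<close> exactly when none of the events ``the gcd of this pair exceeds \<open>K\<close>''
  occurs. With \<open>K\<close> the integer part of \<open>t * (m choose 2)\<close> these events are rare and almost
  independent, so the number of them that occur is approximately Poisson, and the probability that
  none occurs is close to \<open>exp (- \<lambda>)\<close> with \<open>\<lambda>\<close> the expected number. Two estimates remain.

  The rate. Two uniform variables on \<open>{1..N}\<close> have gcd \<open>d\<close> with probability approximately
  \<open>1 / (zeta 2 * d^2)\<close> when \<open>N / d\<close> is large, because dividing by \<open>d\<close> reduces to coprime pairs in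
  \<open>{1..N div d}\<close>, whose density tends to \<open>1 / zeta 2\<close> (\<open>coprime_density_tendsto\<close>). Summing over
  \<open>d > K\<close> gives probability approximately \<open>1 / (zeta 2 * K)\<close>, provided \<open>K / N\<close> tends to \<open>0\<close>
  (\<open>sum_gcd_density_tail_asymptotics\<close>); this is where \<open>\<beta> > 2\<close> enters. Hence \<open>\<lambda>\<close> tends to
  \<open>1 / (t * zeta 2)\<close>. The density of coprime pairs is found without Moebius inversion: sorting the
  pairs by their gcd gives a linear relation between the densities at \<open>N\<close> and at all \<open>N div d\<close>, for
  which the deviation from \<open>1 / zeta 2\<close> contracts by a factor close to \<open>zeta 2 - 1 < 1\<close>.

  The dependence. Events of pairs without a common index are independent. For pairs that share one
  index, both gcds exceed \<open>K\<close> with probability at most \<open>4 * harm N / K^2\<close>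
  (\<open>prob_two_gcds_exceed_le\<close>), and there are of order \<open>m^3\<close> such combinations. The error of the
  Poisson approximation (\<open>prob_none_poisson_approx\<close>) is therefore of order
  \<open>m^3 * (1 + ln N) / K^2\<close>, that is of order \<open>(1 + ln N) / m\<close>, and it vanishes in the limit because
  \<open>ln N \<le> m powr \<gamma>\<close> with \<open>\<gamma> < 1 / 3\<close>.
\<close>

section \<open>Sums of inverse squares\<close>

lemma sum_inverse_squares_le_half_shift:
  "(\<Sum>d=A+1..B. 1 / (real d)\<^sup>2) \<le> 2 / (real A + 1)"
proof (cases "A \<le> B")
  case True
  have "(\<Sum>d=A+1..B. 1 / (real d)\<^sup>2) \<le> 2 * (1 / (real A + 1) - 1 / (real B + 1))"
    using True
  proof (induction B rule: dec_induct)
    case (step B)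
    have "1 / (real (Suc B))\<^sup>2 \<le> 2 * (1 / (real B + 1) - 1 / (real (Suc B) + 1))"
    proof -
      have "2 * (1 / (real B + 1) - 1 / (real (Suc B) + 1)) = 2 / ((real B + 1) * (real B + 2))"
        by (simp add: field_simps)
      also have "\<dots> \<ge> 2 / ((real B + 1) * (2 * (real B + 1)))"
        by (intro divide_left_mono mult_left_mono mult_pos_pos) auto
      also have "2 / ((real B + 1) * (2 * (real B + 1))) = 1 / (real (Suc B))\<^sup>2"
      proof -
        have "2 / (x * (2 * x)) = 1 / x\<^sup>2" for x :: real
          by (simp add: power2_eq_square)
        from this[of "real (Suc B)"] show ?thesis by (simp only: of_nat_Suc add.commute)
      qed
      finally show ?thesis .
    qed
    with step show ?case by simp
  qed simp
  also have "\<dots> \<le> 2 / (real A + 1)" by simp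
  finally show ?thesis .
qed simp

lemma sum_inverse_squares_le:
  assumes "A \<ge> 1"
  shows "(\<Sum>d=A+1..B. 1 / (real d)\<^sup>2) \<le> 1 / real A"
proof (cases "A \<le> B")
  case True
  have "(\<Sum>d=A+1..B. 1 / (real d)\<^sup>2) \<le> 1 / real A - 1 / real B"
    using True
  proof (induction B rule: dec_induct)
    case (step B)
    have "1 / (real (Suc B))\<^sup>2 \<le> 1 / real B - 1 / real (Suc B)"
    proof -
      have B: "real B > 0" using step assms by simp
      hence "1 / real B - 1 / real (Suc B) = 1 / (real B * real (Suc B))"
        by (simp add: field_simps)
      also have "\<dots> \<ge> 1 / (real (Suc B) * real (Suc B))"
        using B by (intro divide_left_mono mult_right_mono mult_pos_pos) auto
      finally show ?thesis by (simp add: power2_eq_square)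
    qed
    with step show ?case by simp
  qed simp
  also have "\<dots> \<le> 1 / real A" by simp
  finally show ?thesis .
qed simp

lemma sum_inverse_squares_ge:
  assumes "A \<le> B"
  shows "1 / (real A + 1) - 1 / (real B + 1) \<le> (\<Sum>d=A+1..B. 1 / (real d)\<^sup>2)"
  using assms
proof (induction B rule: dec_induct)
  case (step B)
  have "1 / (real B + 1) - 1 / (real (Suc B) + 1) \<le> 1 / (real (Suc B))\<^sup>2"
  proof -
    have "1 / (real B + 1) - 1 / (real (Suc B) + 1) = 1 / (real (Suc B) * (real B + 2))"
      by (simp add: field_simps)
    also have "\<dots> \<le> 1 / (real (Suc B) * real (Suc B))"
      by (intro divide_left_mono mult_left_mono mult_pos_pos) auto
    finally show ?thesis by (simp add: power2_eq_square)
  qed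
  with step show ?case by simp
qed simp

text \<open>The multiples of \<open>g\<close> beyond \<open>K\<close> are \<open>g * a\<close> with \<open>a > K div g\<close>, so this is \<open>1 / g^2\<close> times a
tail of the series of inverse squares that starts near \<open>K / g\<close>.\<close>

lemma sum_inverse_squares_multiples_le:
  assumes "K \<ge> 1" "g \<ge> 1"
  shows "(\<Sum>d | d \<in> {K+1..N} \<and> g dvd d. 1 / (real d)\<^sup>2) \<le> 2 / (real g * real K)"
proof -
  define A where "A = K div g"
  have "(\<Sum>d | d \<in> {K+1..N} \<and> g dvd d. 1 / (real d)\<^sup>2) = (\<Sum>a=A+1..N div g. 1 / (real (g * a))\<^sup>2)"
  proof (rule sum.reindex_bij_witness[of _ "\<lambda>a. g * a" "\<lambda>d. d div g"])
    fix d assume d: "d \<in> {d. d \<in> {K+1..N} \<and> g dvd d}"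
    then obtain a where a: "d = g * a" by (auto elim: dvdE)
    have "K div g < a" using d a assms by (simp add: div_less_iff_less_mult mult.commute)
    moreover have "a \<le> N div g" using d a assms by (simp add: less_eq_div_iff_mult_less_eq mult.commute)
    ultimately show "d div g \<in> {A+1..N div g}" using a assms by (simp add: A_def)
  next
    fix a assume a: "a \<in> {A+1..N div g}"
    then have "K < g * a" "g * a \<le> N" using assms
      by (auto simp: A_def Suc_le_eq div_less_iff_less_mult less_eq_div_iff_mult_less_eq mult.commute)
    then show "g * a \<in> {d. d \<in> {K+1..N} \<and> g dvd d}" by simp
  qed (use assms in auto)
  also have "\<dots> = (1 / (real g)\<^sup>2) * (\<Sum>a=A+1..N div g. 1 / (real a)\<^sup>2)"
    by (simp add: sum_distrib_left power_mult_distrib)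
  also have "\<dots> \<le> (1 / (real g)\<^sup>2) * (2 / (real A + 1))"
    by (intro mult_left_mono sum_inverse_squares_le_half_shift) simp
  also have "\<dots> = 2 / (real g * (real g * (real A + 1)))"
    by (simp add: power2_eq_square)
  also have "\<dots> \<le> 2 / (real g * real K)"
  proof -
    have "K < g * (A + 1)" unfolding A_def
      using assms by (metis Suc_eq_plus1 dividend_less_times_div mult_Suc_right add.commute less_le_trans zero_less_one)
    hence "real K \<le> real g * (real A + 1)"
      by (metis Suc_eq_plus1 less_imp_le of_nat_Suc of_nat_le_iff of_nat_mult add.commute)
    thus ?thesis using assms by (intro divide_left_mono mult_left_mono mult_pos_pos) auto
  qed
  finally show ?thesis .
qed

lemma zeta_2_sums: "(\<lambda>k. 1 / (real (Suc k))\<^sup>2) sums zeta 2"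
  using summable_zeta[of 2] by (simp add: zeta_def summable_sums del: of_nat_Suc)

lemma zeta_2_ge_partial: "(\<Sum>d=1..N. 1 / (real d)\<^sup>2) \<le> zeta 2"
proof -
  have "(\<Sum>d=1..N. 1 / (real d)\<^sup>2) = (\<Sum>k<N. 1 / (real (Suc k))\<^sup>2)"
    by (rule sum.reindex_bij_witness[of _ Suc "\<lambda>d. d - 1"]) auto
  also have "\<dots> \<le> zeta 2"
    unfolding sums_unique[OF zeta_2_sums]
    by (rule sum_le_suminf) (use sums_summable[OF zeta_2_sums] in auto)
  finally show ?thesis .
qed

lemma zeta_2_le_partial:
  assumes "N \<ge> 1"
  shows "zeta 2 \<le> (\<Sum>d=1..N. 1 / (real d)\<^sup>2) + 1 / real N"
proof (rule LIMSEQ_le_const2)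
  show "(\<lambda>B. \<Sum>d=1..B. 1 / (real d)\<^sup>2) \<longlonglongrightarrow> zeta 2"
  proof -
    have "(\<Sum>d=1..B. 1 / (real d)\<^sup>2) = (\<Sum>k<B. 1 / (real (Suc k))\<^sup>2)" for B
      by (rule sum.reindex_bij_witness[of _ Suc "\<lambda>d. d - 1"]) auto
    thus ?thesis using zeta_2_sums by (simp add: sums_def)
  qed
  show "\<exists>B0. \<forall>B\<ge>B0. (\<Sum>d=1..B. 1 / (real d)\<^sup>2) \<le> (\<Sum>d=1..N. 1 / (real d)\<^sup>2) + 1 / real N"
  proof (intro exI allI impI)
    fix B assume "N \<le> B"
    hence "{1..B} = {1..N} \<union> {N+1..B}" by auto
    hence "(\<Sum>d=1..B. 1 / (real d)\<^sup>2) = (\<Sum>d=1..N. 1 / (real d)\<^sup>2) + (\<Sum>d=N+1..B. 1 / (real d)\<^sup>2)"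
      by (simp add: sum.union_disjoint)
    thus "(\<Sum>d=1..B. 1 / (real d)\<^sup>2) \<le> (\<Sum>d=1..N. 1 / (real d)\<^sup>2) + 1 / real N"
      using sum_inverse_squares_le[OF assms, of B] by simp
  qed
qed

lemma zeta_2_ge_1: "zeta 2 \<ge> 1"
  using zeta_2_ge_partial[of 1] by simp

text \<open>The contraction argument for the density of coprime pairs depends on \<open>zeta 2 - 1\<close> being less than
\<open>1\<close>.\<close>

lemma zeta_2_less_2: "zeta 2 < 2"
  using zeta_2_le_partial[of 2] by (simp add: numeral_2_eq_2)

section \<open>The density of pairs with a given gcd\<close>

definition gcd_pairs :: "nat \<Rightarrow> nat \<Rightarrow> (nat \<times> nat) set" where
  "gcd_pairs N d = {(x, y). x \<in> {1..N} \<and> y \<in> {1..N} \<and> gcd x y = d}"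

lemma finite_gcd_pairs [simp]: "finite (gcd_pairs N d)"
  by (rule finite_subset[of _ "{1..N} \<times> {1..N}"]) (auto simp: gcd_pairs_def)

text \<open>Dividing both entries by \<open>d\<close> turns a pair with gcd \<open>d\<close> into a coprime pair.\<close>

lemma card_gcd_pairs_scale:
  assumes "d \<ge> 1"
  shows "card (gcd_pairs N d) = card (gcd_pairs (N div d) 1)"
proof (rule bij_betw_same_card[symmetric], rule bij_betwI')
  fix x y :: "nat \<times> nat"
  show "((d * fst x, d * snd x) = (d * fst y, d * snd y)) \<longleftrightarrow> x = y"
    using assms by (auto simp: prod_eq_iff)
next
  fix x assume "x \<in> gcd_pairs (N div d) 1"
  then show "(d * fst x, d * snd x) \<in> gcd_pairs N d"
    using assms by (auto simp: gcd_pairs_def less_eq_div_iff_mult_less_eq mult.commute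
        simp flip: gcd_mult_distrib_nat)
next
  fix y assume y: "y \<in> gcd_pairs N d"
  obtain u v where uv: "y = (u, v)" by force
  have "d dvd u" "d dvd v" using y uv by (auto simp: gcd_pairs_def)
  then obtain a b where ab: "u = d * a" "v = d * b" by (auto elim!: dvdE)
  have "(a, b) \<in> gcd_pairs (N div d) 1"
    using y assms gcd_mult_distrib_nat[of d a b]
    by (auto simp: gcd_pairs_def uv ab less_eq_div_iff_mult_less_eq mult.commute)
  then show "\<exists>x\<in>gcd_pairs (N div d) 1. y = (d * fst x, d * snd x)"
    by (intro bexI[of _ "(a, b)"]) (auto simp: uv ab)
qed

lemma card_gcd_pairs_le: "card (gcd_pairs N d) \<le> N\<^sup>2"
proof -
  have "card (gcd_pairs N d) \<le> card ({1..N} \<times> {1..N})"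
    by (rule card_mono) (auto simp: gcd_pairs_def)
  thus ?thesis by (simp add: power2_eq_square)
qed

text \<open>Every pair has exactly one gcd. Together with the scaling above, this identity determines the density
of coprime pairs.\<close>

lemma sum_card_gcd_pairs: "(\<Sum>d=1..N. card (gcd_pairs N d)) = N\<^sup>2"
proof -
  have "(\<Union>d\<in>{1..N}. gcd_pairs N d) = {1..N} \<times> {1..N}"
    by (auto simp: gcd_pairs_def Suc_le_eq intro: le_trans[OF gcd_le1_nat])
  moreover have "card (\<Union>d\<in>{1..N}. gcd_pairs N d) = (\<Sum>d=1..N. card (gcd_pairs N d))"
    by (rule card_UN_disjoint) (simp, simp, auto simp: gcd_pairs_def)
  ultimately show ?thesis by (simp add: power2_eq_square)
qed

definition gcd_density :: "nat \<Rightarrow> nat \<Rightarrow> real" where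
  "gcd_density N d = real (card (gcd_pairs N d)) / (real N)\<^sup>2"

definition coprime_density :: "nat \<Rightarrow> real" where
  "coprime_density N = gcd_density N 1"

lemma coprime_density_bounds: "0 \<le> coprime_density N" "coprime_density N \<le> 1"
  using card_gcd_pairs_le[of N 1]
  by (auto simp: coprime_density_def gcd_density_def divide_le_eq simp flip: of_nat_power)

text \<open>The scaling of pairs in terms of densities. The second factor is a rounding error, close to \<open>1\<close>
when \<open>N\<close> is much larger than \<open>d\<close>.\<close>

lemma gcd_density_eq:
  assumes "d \<ge> 1" "N \<ge> d"
  shows "(real d)\<^sup>2 * gcd_density N d
       = coprime_density (N div d) * (real d * real (N div d) / real N)\<^sup>2"
  using assms by (simp add: gcd_density_def coprime_density_def card_gcd_pairs_scale[OF assms(1)]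
      power_mult_distrib power_divide div_eq_0_iff)

lemma div_mult_ratio_bounds:
  assumes "d \<ge> 1" "N \<ge> d"
  shows "real d * real (N div d) / real N \<le> 1" "1 - real d / real N \<le> real d * real (N div d) / real N"
proof -
  have "d * (N div d) \<le> N" by simp
  hence "real d * real (N div d) \<le> real N" by (simp flip: of_nat_mult)
  thus "real d * real (N div d) / real N \<le> 1" using assms by (simp add: divide_le_eq)
  have "N \<le> d * (N div d) + d" using assms
    by (metis add_left_mono less_imp_le mod_less_divisor mult_div_mod_eq zero_less_one less_le_trans)
  hence "real N \<le> real d * real (N div d) + real d" by (simp flip: of_nat_mult of_nat_add)
  thus "1 - real d / real N \<le> real d * real (N div d) / real N"
    using assms by (simp add: pos_le_divide_eq left_diff_distrib)
qed

lemma gcd_density_bounds: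
  assumes "d \<ge> 1" "N \<ge> d"
  shows "0 \<le> (real d)\<^sup>2 * gcd_density N d" "(real d)\<^sup>2 * gcd_density N d \<le> 1"
proof -
  have "(real d * real (N div d) / real N)\<^sup>2 \<le> 1"
    using div_mult_ratio_bounds[OF assms] by (simp add: power_le_one)
  thus "(real d)\<^sup>2 * gcd_density N d \<le> 1"
    unfolding gcd_density_eq[OF assms]
    by (intro mult_le_one coprime_density_bounds) auto
qed (simp add: gcd_density_def)

text \<open>After multiplication by \<open>d^2\<close>, the density of gcd \<open>d\<close> is as close to any constant \<open>c\<close> as the density
of coprime pairs at \<open>N div d\<close>, up to the rounding error. This is used with \<open>c = 1 / zeta 2\<close>.\<close>

lemma gcd_density_dist_le:
  assumes "d \<ge> 1" "N \<ge> d"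
  shows "\<bar>(real d)\<^sup>2 * gcd_density N d - c\<bar>
       \<le> \<bar>coprime_density (N div d) - c\<bar> + 2 * (real d / real N)"
proof -
  define a where "a = coprime_density (N div d)"
  define r where "r = real d * real (N div d) / real N"
  have r: "0 \<le> r" "r \<le> 1" "1 - r \<le> real d / real N"
    using div_mult_ratio_bounds[OF assms] by (auto simp: r_def)
  have a: "0 \<le> a" "a \<le> 1" using coprime_density_bounds by (auto simp: a_def)
  have "1 - r\<^sup>2 = (1 - r) * (1 + r)" by (simp add: power2_eq_square algebra_simps)
  also have "\<dots> \<le> (1 - r) * 2" using r by (intro mult_left_mono) auto
  finally have r2: "1 - r\<^sup>2 \<le> 2 * (real d / real N)" using r by simp
  have r1: "0 \<le> 1 - r\<^sup>2" using r by (simp add: power_le_one)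
  define t where "t = a * (1 - r\<^sup>2)"
  have "t \<le> 1 * (1 - r\<^sup>2)" unfolding t_def using a r1 by (intro mult_right_mono) auto
  hence t: "0 \<le> t" "t \<le> 2 * (real d / real N)" using a r1 r2 by (auto simp: t_def)
  have "a * r\<^sup>2 - c = (a - c) - t" by (simp add: t_def algebra_simps)
  hence "\<bar>a * r\<^sup>2 - c\<bar> \<le> \<bar>a - c\<bar> + 2 * (real d / real N)"
    using t by linarith
  thus ?thesis by (simp add: gcd_density_eq[OF assms] a_def r_def)
qed

text \<open>Let \<open>c = 1 / zeta 2\<close>. The densities of all gcds sum to \<open>1\<close>, and so do the numbers \<open>c / d^2\<close>.
Subtracting these two identities expresses the deviation at \<open>d = 1\<close>, that is of the coprime density
from \<open>c\<close>, by the deviations at \<open>d \<ge> 2\<close>. For \<open>d\<close> up to a fixed bound \<open>D\<close>, the deviation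
at \<open>d\<close> is at most about \<open>B / d^2\<close>, because \<open>N div d\<close> is large as well; larger \<open>d\<close> contribute
at most \<open>1 / D\<close>. The sum of \<open>1 / d^2\<close> over \<open>d \<ge> 2\<close> is \<open>zeta 2 - 1\<close>.\<close>

lemma coprime_density_contraction:
  assumes "B \<ge> 0" "\<delta> > 0" "\<forall>\<^sub>F N in sequentially. \<bar>coprime_density N - 1 / zeta 2\<bar> \<le> B"
  shows "\<forall>\<^sub>F N in sequentially. \<bar>coprime_density N - 1 / zeta 2\<bar> \<le> (zeta 2 - 1) * B + \<delta>"
proof -
  define c where "c = 1 / zeta 2"
  have c: "0 < c" "c \<le> 1" using zeta_2_ge_1 by (auto simp: c_def)
  obtain Q where Q: "\<And>q. q \<ge> Q \<Longrightarrow> \<bar>coprime_density q - c\<bar> \<le> B"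
    using assms(3) by (auto simp: eventually_sequentially c_def)
  define D where "D = nat \<lceil>8 / \<delta>\<rceil> + 2"
  have D: "real D \<ge> 8 / \<delta>" "D \<ge> 2" unfolding D_def by linarith+
  have "\<bar>coprime_density N - c\<bar> \<le> (zeta 2 - 1) * B + \<delta>"
    if N: "N \<ge> D + 1" "N \<ge> Q * D" "real N \<ge> 8 * real D / \<delta>" for N
  proof -
    have N1: "N \<ge> 1" using N by simp
    \<comment> \<open>\<open>u d\<close> is the deviation of the density of gcd \<open>d\<close> from \<open>c / d^2\<close>; the range of \<open>d\<close> is split at \<open>1\<close> and \<open>D\<close>.\<close>
    define u where "u d = (c - (real d)\<^sup>2 * gcd_density N d) / (real d)\<^sup>2" for d
    have "(\<Sum>d=1..N. gcd_density N d) = real (\<Sum>d=1..N. card (gcd_pairs N d)) / (real N)\<^sup>2"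
      by (simp add: gcd_density_def sum_divide_distrib)
    also have "\<dots> = 1" using N1 unfolding sum_card_gcd_pairs by simp
    finally have tot: "(\<Sum>d=1..N. gcd_density N d) = 1" .
    have split: "{1..N} = insert 1 ({2..D} \<union> {D+1..N})" using N D by auto
    have "(\<Sum>d=1..N. u d) = (\<Sum>d=1..N. c * (1 / (real d)\<^sup>2) - gcd_density N d)"
      by (rule sum.cong) (auto simp: u_def diff_divide_distrib)
    also have "\<dots> = c * (\<Sum>d=1..N. 1 / (real d)\<^sup>2) - 1"
      using tot by (simp add: sum_subtractf sum_distrib_left)
    finally have "(\<Sum>d=1..N. u d) = c * (\<Sum>d=1..N. 1 / (real d)\<^sup>2) - 1" .
    moreover have "(\<Sum>d=1..N. u d) = u 1 + (\<Sum>d=2..D. u d) + (\<Sum>d=D+1..N. u d)"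
      unfolding split using D by (subst sum.insert) (auto simp: sum.union_disjoint)
    moreover have "u 1 = c - coprime_density N"
      by (simp add: u_def coprime_density_def)
    moreover have "c * zeta 2 = 1" using zeta_2_ge_1 by (simp add: c_def)
    ultimately have "coprime_density N - c
        = (\<Sum>d=2..D. u d) + (\<Sum>d=D+1..N. u d) + c * (zeta 2 - (\<Sum>d=1..N. 1 / (real d)\<^sup>2))"
      by (simp add: algebra_simps)
    moreover have "\<bar>c * (zeta 2 - (\<Sum>d=1..N. 1 / (real d)\<^sup>2))\<bar> \<le> 1 * (1 / real N)"
      unfolding abs_mult using c zeta_2_ge_partial[of N] zeta_2_le_partial[OF N1]
      by (intro mult_mono) auto
    moreover have "\<bar>\<Sum>d=D+1..N. u d\<bar> \<le> 1 / real D"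
    proof -
      have "\<bar>\<Sum>d=D+1..N. u d\<bar> \<le> (\<Sum>d=D+1..N. 1 / (real d)\<^sup>2)"
      proof (rule order_trans[OF sum_abs], rule sum_mono)
        fix d assume "d \<in> {D+1..N}"
        hence "\<bar>c - (real d)\<^sup>2 * gcd_density N d\<bar> \<le> 1"
          using gcd_density_bounds[of d N] c by auto
        thus "\<bar>u d\<bar> \<le> 1 / (real d)\<^sup>2" by (simp add: u_def divide_right_mono)
      qed
      thus ?thesis using sum_inverse_squares_le[of D N] D by linarith
    qed
    moreover have "\<bar>\<Sum>d=2..D. u d\<bar> \<le> (B + 2 * (real D / real N)) * (zeta 2 - 1)"
    proof -
      have "\<bar>\<Sum>d=2..D. u d\<bar> \<le> (\<Sum>d=2..D. (B + 2 * (real D / real N)) * (1 / (real d)\<^sup>2))"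
      proof (rule order_trans[OF sum_abs], rule sum_mono)
        fix d assume d: "d \<in> {2..D}"
        have "Q * d \<le> N" using d by (intro le_trans[OF _ N(2)]) simp
        hence "Q \<le> N div d" using d N by (simp add: less_eq_div_iff_mult_less_eq)
        hence "\<bar>c - (real d)\<^sup>2 * gcd_density N d\<bar> \<le> B + 2 * (real d / real N)"
          using gcd_density_dist_le[of d N c] Q[of "N div d"] d N by auto
        also have "\<dots> \<le> B + 2 * (real D / real N)" using d by (auto intro!: divide_right_mono)
        finally show "\<bar>u d\<bar> \<le> (B + 2 * (real D / real N)) * (1 / (real d)\<^sup>2)"
          by (simp add: u_def divide_right_mono)
      qed
      also have "\<dots> = (B + 2 * (real D / real N)) * (\<Sum>d=2..D. 1 / (real d)\<^sup>2)"
        by (simp add: sum_distrib_left)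
      also have "(\<Sum>d=2..D. 1 / (real d)\<^sup>2) = (\<Sum>d=1..D. 1 / (real d)\<^sup>2) - 1"
        using D sum.atLeast_Suc_atMost[of 1 D "\<lambda>d. 1 / (real d)\<^sup>2"]
        by (simp add: numeral_2_eq_2)
      also have "(B + 2 * (real D / real N)) * \<dots> \<le> (B + 2 * (real D / real N)) * (zeta 2 - 1)"
        using zeta_2_ge_partial[of D] assms by (intro mult_left_mono) auto
      finally show ?thesis .
    qed
    moreover have "2 * (real D / real N) * (zeta 2 - 1) \<le> 2 * (real D / real N) * 1"
      using zeta_2_less_2 by (intro mult_left_mono) auto
    moreover have "real D / real N \<le> \<delta> / 8" using N N1 assms by (simp add: field_simps)
    moreover have "1 / real D \<le> \<delta> / 8" using D assms by (simp add: field_simps)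
    moreover have "1 / real N \<le> 1 / real D" using N D by (intro divide_left_mono) auto
    moreover have "(B + 2 * (real D / real N)) * (zeta 2 - 1)
        = (zeta 2 - 1) * B + 2 * (real D / real N) * (zeta 2 - 1)" by (simp add: algebra_simps)
    ultimately show ?thesis using assms(2) by linarith
  qed
  moreover have "\<forall>\<^sub>F N in sequentially. N \<ge> D + 1 \<and> N \<ge> Q * D \<and> real N \<ge> 8 * real D / \<delta>"
    by (intro eventually_conj eventually_ge_at_top) real_asymp
  ultimately show ?thesis unfolding c_def by (auto elim: eventually_mono)
qed

text \<open>The deviation is at most \<open>1\<close>, and each application of the contraction lemma multiplies an eventual
bound by \<open>\<rho> = zeta 2 / 2\<close>, which lies strictly between \<open>zeta 2 - 1\<close> and \<open>1\<close> and so leaves room for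
the error term \<open>\<delta>\<close>.\<close>

theorem coprime_density_tendsto: "coprime_density \<longlonglongrightarrow> 1 / zeta 2"
proof -
  define \<rho> where "\<rho> = zeta 2 / 2"
  have \<rho>: "0 < \<rho>" "\<rho> < 1" "zeta 2 - 1 < \<rho>"
    using zeta_2_ge_1 zeta_2_less_2 by (auto simp: \<rho>_def)
  have iter: "\<forall>\<^sub>F N in sequentially. \<bar>coprime_density N - 1 / zeta 2\<bar> \<le> \<rho> ^ j" for j
  proof (induction j)
    case 0
    have "\<bar>coprime_density N - 1 / zeta 2\<bar> \<le> 1" for N
    proof -
      have "0 \<le> 1 / zeta 2" "1 / zeta 2 \<le> 1" using zeta_2_ge_1 by auto
      thus ?thesis using coprime_density_bounds[of N] by linarith
    qed
    thus ?case by simp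
  next
    case (Suc j)
    have "(\<rho> - (zeta 2 - 1)) * \<rho> ^ j > 0" using \<rho> by simp
    from coprime_density_contraction[OF _ this Suc] show ?case
      using \<rho> by (simp add: algebra_simps)
  qed
  show ?thesis
  proof (rule LIMSEQ_I)
    fix r :: real assume "r > 0"
    then obtain j where "\<rho> ^ j < r" using real_arch_pow_inv[of r \<rho>] \<rho> by auto
    with iter[of j] obtain N0 where "\<forall>N\<ge>N0. \<bar>coprime_density N - 1 / zeta 2\<bar> \<le> \<rho> ^ j"
      by (auto simp: eventually_sequentially)
    with \<open>\<rho> ^ j < r\<close> show "\<exists>N0. \<forall>N\<ge>N0. norm (coprime_density N - 1 / zeta 2) < r"
      by (intro exI[of _ N0]) force
  qed
qed

text \<open>The gcds \<open>d\<close> with \<open>N \<ge> M * d\<close>, for a large constant \<open>M\<close>, have density about \<open>1 / (zeta 2 * d^2)\<close>, and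
the sum of \<open>1 / d^2\<close> over \<open>d > K\<close> is about \<open>1 / K\<close>. The remaining gcds \<open>d > N / M\<close> contribute at
most about \<open>M / N\<close>, which is negligible against \<open>1 / K\<close>.\<close>

lemma sum_gcd_density_tail_asymptotics:
  fixes N K :: "nat \<Rightarrow> nat"
  assumes K: "filterlim K at_top sequentially"
    and KN: "(\<lambda>m. real (K m) / real (N m)) \<longlonglongrightarrow> 0"
    and N_pos: "\<And>m. N m \<ge> 1"
  shows "(\<lambda>m. real (K m) * (\<Sum>d=K m + 1..N m. gcd_density (N m) d)) \<longlonglongrightarrow> 1 / zeta 2"
proof (rule tendstoI)
  fix \<epsilon> :: real assume \<epsilon>: "\<epsilon> > 0"
  define c where "c = 1 / zeta 2"
  have c: "0 < c" "c \<le> 1" using zeta_2_ge_1 by (auto simp: c_def)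
  have "\<forall>\<^sub>F q in sequentially. \<bar>coprime_density q - c\<bar> < \<epsilon> / 8"
    using tendstoD[OF coprime_density_tendsto, of "\<epsilon> / 8"] \<epsilon> by (simp add: dist_real_def c_def)
  then obtain Q where Q: "\<And>q. q \<ge> Q \<Longrightarrow> \<bar>coprime_density q - c\<bar> < \<epsilon> / 8"
    by (auto simp: eventually_sequentially)
  define M where "M = max Q (nat \<lceil>16 / \<epsilon>\<rceil> + 1)"
  have M: "M \<ge> Q" "M \<ge> 1" "real M \<ge> 16 / \<epsilon>" unfolding M_def by linarith+
  have *: "\<bar>real K * (\<Sum>d=K+1..N. gcd_density N d) - c\<bar> < \<epsilon>"
    if K: "K \<ge> 1" "8 / \<epsilon> \<le> real K" and KN: "real K / real N < min 1 (\<epsilon> / 24) / real M" and N: "N \<ge> 1"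
    for K N :: nat
  proof -
    \<comment> \<open>\<open>D\<close> separates the gcds to which the density asymptotics apply from the negligible ones.\<close>
    define D where "D = N div M"
    have "real K * real M / real N < min 1 (\<epsilon> / 24)"
      using KN M by (simp add: field_simps)
    hence KMN: "real K * real M / real N < 1" "real K * real M / real N < \<epsilon> / 24" by auto
    hence "real (K * M) < real N" using N by (simp add: divide_less_eq)
    hence "K * M \<le> N" by linarith
    hence KD: "K \<le> D" using M by (simp add: D_def less_eq_div_iff_mult_less_eq)
    have DN: "D \<le> N" by (simp add: D_def)
    have "N < (D + 1) * M" unfolding D_def using M
      by (metis Suc_eq_plus1 dividend_less_div_times less_le_trans zero_less_one add.commute mult_Suc)
    hence "real N \<le> (real D + 1) * real M"
      by (metis Suc_eq_plus1 less_imp_le of_nat_Suc of_nat_le_iff of_nat_mult add.commute)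
    hence "real K * real N \<le> real K * ((real D + 1) * real M)" by (intro mult_left_mono) auto
    hence "real K / (real D + 1) \<le> real K * real M / real N"
      using N by (simp add: field_simps)
    hence KD1: "real K / (real D + 1) < \<epsilon> / 24" using KMN by linarith
    define S1 where "S1 = (\<Sum>d=K+1..D. 1 / (real d)\<^sup>2)"
    define T1 where "T1 = (\<Sum>d=K+1..D. gcd_density N d)"
    define T2 where "T2 = (\<Sum>d=D+1..N. gcd_density N d)"
    have "{K+1..N} = {K+1..D} \<union> {D+1..N}" using KD DN by auto
    hence T: "(\<Sum>d=K+1..N. gcd_density N d) = T1 + T2"
      by (simp add: T1_def T2_def sum.union_disjoint)
    have "\<bar>T1 - c * S1\<bar> \<le> \<epsilon> / 4 * S1"
    proof -
      have "\<bar>T1 - c * S1\<bar> = \<bar>\<Sum>d=K+1..D. gcd_density N d - c * (1 / (real d)\<^sup>2)\<bar>"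
        by (simp add: T1_def S1_def sum_subtractf sum_distrib_left)
      also have "\<dots> \<le> (\<Sum>d=K+1..D. \<epsilon> / 4 * (1 / (real d)\<^sup>2))"
      proof (rule order_trans[OF sum_abs], rule sum_mono)
        fix d assume d: "d \<in> {K+1..D}"
        have dM: "d * M \<le> N" using d M by (simp add: D_def less_eq_div_iff_mult_less_eq)
        hence "M \<le> N div d" using d by (simp add: less_eq_div_iff_mult_less_eq mult.commute)
        hence "\<bar>coprime_density (N div d) - c\<bar> < \<epsilon> / 8" using M by (intro Q) simp
        moreover have "real d * real M \<le> real N" using dM by (simp flip: of_nat_mult)
        hence "real d / real N \<le> 1 / real M" using N M by (simp add: field_simps)
        moreover have "1 / real M \<le> \<epsilon> / 16" using M \<epsilon> by (simp add: field_simps)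
        ultimately have "\<bar>(real d)\<^sup>2 * gcd_density N d - c\<bar> \<le> \<epsilon> / 4"
          using gcd_density_dist_le[of d N c] d DN by force
        hence "\<bar>(real d)\<^sup>2 * gcd_density N d - c\<bar> / (real d)\<^sup>2 \<le> \<epsilon> / 4 / (real d)\<^sup>2"
          by (intro divide_right_mono) auto
        moreover have "gcd_density N d - c * (1 / (real d)\<^sup>2)
            = ((real d)\<^sup>2 * gcd_density N d - c) / (real d)\<^sup>2"
          using d by (simp add: diff_divide_distrib)
        ultimately show "\<bar>gcd_density N d - c * (1 / (real d)\<^sup>2)\<bar> \<le> \<epsilon> / 4 * (1 / (real d)\<^sup>2)"
          by simp
      qed
      finally show ?thesis by (simp add: S1_def sum_distrib_left)
    qed
    hence "real K * \<bar>T1 - c * S1\<bar> \<le> real K * (\<epsilon> / 4 * S1)" by (intro mult_left_mono) auto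
    hence 1: "\<bar>real K * T1 - c * (real K * S1)\<bar> \<le> \<epsilon> / 4 * (real K * S1)"
      by (simp add: abs_mult[of "real K", symmetric, simplified] algebra_simps)
    have "S1 \<le> 1 / real K" unfolding S1_def by (rule sum_inverse_squares_le) (use K in simp)
    hence S1_le: "real K * S1 \<le> 1" using K by (simp add: field_simps)
    have "real K * (1 / (real K + 1) - 1 / (real D + 1)) \<le> real K * S1"
      unfolding S1_def by (intro mult_left_mono sum_inverse_squares_ge KD) simp
    moreover have "real K * (1 / (real K + 1) - 1 / (real D + 1))
        = 1 - 1 / (real K + 1) - real K / (real D + 1)" by (simp add: field_simps)
    moreover have "1 / (real K + 1) \<le> \<epsilon> / 8"
    proof -
      have "8 / \<epsilon> \<le> real K + 1" using K by simp
      thus ?thesis using \<epsilon> by (simp add: field_simps)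
    qed
    ultimately have S1_ge: "real K * S1 \<ge> 1 - \<epsilon> / 8 - \<epsilon> / 24" using KD1 by linarith
    have "\<bar>c * (real K * S1 - 1)\<bar> \<le> 1 * (\<epsilon> / 8 + \<epsilon> / 24)"
      unfolding abs_mult using c S1_le S1_ge \<epsilon> by (intro mult_mono) auto
    moreover have "\<epsilon> / 4 * (real K * S1) \<le> \<epsilon> / 4 * 1"
      using S1_le \<epsilon> by (intro mult_left_mono) auto
    moreover have "0 \<le> real K * T2" "real K * T2 < \<epsilon> / 12"
    proof -
      have "T2 \<le> (\<Sum>d=D+1..N. 1 / (real d)\<^sup>2)" unfolding T2_def
      proof (rule sum_mono)
        fix d assume "d \<in> {D+1..N}"
        thus "gcd_density N d \<le> 1 / (real d)\<^sup>2"
          using gcd_density_bounds[of d N] by (simp add: pos_le_divide_eq mult.commute)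
      qed
      also have "\<dots> \<le> 2 / (real D + 1)" by (rule sum_inverse_squares_le_half_shift)
      finally have "real K * T2 \<le> real K * (2 / (real D + 1))" by (intro mult_left_mono) auto
      also have "\<dots> = 2 * (real K / (real D + 1))" by simp
      finally show "real K * T2 < \<epsilon> / 12" using KD1 by linarith
      show "0 \<le> real K * T2" by (auto simp: T2_def gcd_density_def intro!: mult_nonneg_nonneg sum_nonneg)
    qed
    moreover have "real K * (T1 + T2) - c
        = (real K * T1 - c * (real K * S1)) + c * (real K * S1 - 1) + real K * T2"
      by (simp add: algebra_simps)
    moreover have "\<bar>x + y + z\<bar> < \<epsilon>"
      if "\<bar>x\<bar> \<le> \<epsilon> / 4" "\<bar>y\<bar> \<le> 1 * (\<epsilon> / 8 + \<epsilon> / 24)" "0 \<le> z" "z < \<epsilon> / 12" for x y z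
      using that \<epsilon> unfolding abs_le_iff abs_less_iff by (auto simp: field_simps)
    moreover have "\<bar>real K * T1 - c * (real K * S1)\<bar> \<le> \<epsilon> / 4"
      using 1 calculation(2) by simp
    ultimately show ?thesis unfolding T by metis
  qed
  have "\<forall>\<^sub>F m in sequentially. real (K m) / real (N m) < min 1 (\<epsilon> / 24) / real M"
    using M \<epsilon> by (intro order_tendstoD(2)[OF KN]) auto
  moreover have "\<forall>\<^sub>F m in sequentially. 1 \<le> K m"
    using K by (auto simp: filterlim_at_top)
  moreover have "\<forall>\<^sub>F m in sequentially. 8 / \<epsilon> \<le> real (K m)"
    using filterlim_compose[OF filterlim_real_sequentially K] by (auto simp: filterlim_at_top)
  ultimately show "\<forall>\<^sub>F m in sequentially.
      dist (real (K m) * (\<Sum>d=K m + 1..N m. gcd_density (N m) d)) (1 / zeta 2) < \<epsilon>"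
    by eventually_elim (unfold dist_real_def c_def[symmetric], intro * N_pos)
qed

section \<open>Poisson approximation for locally dependent events\<close>

context prob_space
begin

lemma expectation_bounded_nat:
  fixes g :: "nat \<Rightarrow> real"
  assumes [measurable]: "W \<in> measurable M (count_space UNIV)"
    and le: "\<And>\<omega>. \<omega> \<in> space M \<Longrightarrow> W \<omega> \<le> n"
  shows "expectation (\<lambda>\<omega>. g (W \<omega>)) = (\<Sum>k\<le>n. g k * prob {\<omega> \<in> space M. W \<omega> = k})"
proof -
  have "expectation (\<lambda>\<omega>. g (W \<omega>))
      = expectation (\<lambda>\<omega>. \<Sum>k\<le>n. g k * indicator {\<omega> \<in> space M. W \<omega> = k} \<omega>)"
  proof (rule Bochner_Integration.integral_cong[OF refl])
    fix \<omega> assume \<omega>: "\<omega> \<in> space M"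
    have "(\<Sum>k\<le>n. g k * indicator {\<omega> \<in> space M. W \<omega> = k} \<omega>) = (\<Sum>k\<le>n. if k = W \<omega> then g k else 0)"
      using \<omega> by (intro sum.cong) (auto simp: indicator_def)
    also have "\<dots> = g (W \<omega>)" using le[OF \<omega>] by simp
    finally show "g (W \<omega>) = (\<Sum>k\<le>n. g k * indicator {\<omega> \<in> space M. W \<omega> = k} \<omega>)" by simp
  qed
  also have "\<dots> = (\<Sum>k\<le>n. g k * prob {\<omega> \<in> space M. W \<omega> = k})"
    by (subst Bochner_Integration.integral_sum) (auto intro!: integrable_mult_right simp: less_top[symmetric])
  finally show ?thesis .
qed

lemma expectation_power_has_derivative:
  assumes W: "W \<in> measurable M (count_space UNIV)"
    and le: "\<And>\<omega>. \<omega> \<in> space M \<Longrightarrow> W \<omega> \<le> n"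
  shows "((\<lambda>s. expectation (\<lambda>\<omega>. (1 - s) ^ W \<omega>)) has_real_derivative
           - expectation (\<lambda>\<omega>. real (W \<omega>) * (1 - s) ^ (W \<omega> - 1))) (at s)"
proof -
  have "((\<lambda>s. \<Sum>k\<le>n. (1 - s) ^ k * prob {\<omega> \<in> space M. W \<omega> = k}) has_real_derivative
      (\<Sum>k\<le>n. - (real k * (1 - s) ^ (k - 1)) * prob {\<omega> \<in> space M. W \<omega> = k})) (at s)"
    by (intro DERIV_sum) (auto intro!: derivative_eq_intros)
  thus ?thesis
    using expectation_bounded_nat[where g="\<lambda>k. (1 - s) ^ k" for s, OF W le]
      expectation_bounded_nat[where g="\<lambda>k. real k * (1 - s) ^ (k - 1)", OF W le]
    by (simp add: sum_negf)
qed

text \<open>The Poisson approximation is proved with the generating function \<open>(1 - s) ^ W\<close> of the number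
\<open>W\<close> of events that occur. Written as a product over the events, it splits into the
contributions of a neighbourhood and of its complement.\<close>

lemma prod_thinned_indicators:
  fixes E :: "'i \<Rightarrow> 'a set"
  assumes "finite A"
  shows "(\<Prod>i\<in>A. 1 - s * indicator (E i) \<omega>) = (1 - s :: real) ^ card {i\<in>A. \<omega> \<in> E i}"
proof -
  have "(\<Prod>i\<in>A. 1 - s * indicator (E i) \<omega>) = (\<Prod>i\<in>A. if \<omega> \<in> E i then 1 - s else 1)"
    by (intro prod.cong) auto
  also have "\<dots> = (1 - s) ^ card {i\<in>A. \<omega> \<in> E i}"
    using assms by (simp add: prod.If_cases Int_def)
  finally show ?thesis .
qed

text \<open>The derivative of the product form with respect to \<open>s\<close>, up to sign.\<close>

lemma sum_prod_thinned_indicators: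
  fixes E :: "'i \<Rightarrow> 'a set"
  assumes "finite A"
  shows "(\<Sum>i\<in>A. indicator (E i) \<omega> * (\<Prod>j\<in>A - {i}. 1 - s * indicator (E j) \<omega>))
       = real (card {i\<in>A. \<omega> \<in> E i}) * (1 - s :: real) ^ (card {i\<in>A. \<omega> \<in> E i} - 1)"
proof -
  define W where "W = {i\<in>A. \<omega> \<in> E i}"
  have "(\<Sum>i\<in>A. indicator (E i) \<omega> * (\<Prod>j\<in>A - {i}. 1 - s * indicator (E j) \<omega>))
      = (\<Sum>i\<in>A. if i \<in> W then (1 - s) ^ (card W - 1) else 0)"
  proof (rule sum.cong[OF refl])
    fix i assume i: "i \<in> A"
    have "card {j\<in>A - {i}. \<omega> \<in> E j} = card W - 1" if "i \<in> W"
    proof -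
      have "{j\<in>A - {i}. \<omega> \<in> E j} = W - {i}" by (auto simp: W_def)
      thus ?thesis using that by simp
    qed
    thus "indicator (E i) \<omega> * (\<Prod>j\<in>A - {i}. 1 - s * indicator (E j) \<omega>)
        = (if i \<in> W then (1 - s) ^ (card W - 1) else 0)"
      using i assms by (auto simp: prod_thinned_indicators W_def)
  qed
  also have "\<dots> = real (card W) * (1 - s) ^ (card W - 1)"
    using assms by (simp add: sum.If_cases W_def Int_def)
  finally show ?thesis by (simp add: W_def)
qed

text \<open>A Chen--Stein bound for the probability that none of the events occurs, where each \<open>E i\<close> is
independent of the number of events outside its neighbourhood \<open>nb i\<close>. Let
\<open>G s = E ((1 - s) ^ W)\<close> and let \<open>L\<close> be the expectation of \<open>W\<close>. For a Poisson variable \<open>G\<close> satisfies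
\<open>G' = - L * G\<close>; here \<open>G' + L * G\<close> is bounded on \<open>[0, 1]\<close> by the right-hand side. Integrating
the derivative of \<open>exp (L * s) * G s\<close> from \<open>s = 0\<close>, where it is \<open>1\<close>, to \<open>s = 1\<close>, where \<open>G\<close> is the
probability that \<open>W = 0\<close>, gives the claim.\<close>

theorem prob_none_poisson_approx:
  fixes E :: "'i \<Rightarrow> 'a set" and nb :: "'i \<Rightarrow> 'i set"
  assumes fin: "finite A" and ev: "\<And>i. i \<in> A \<Longrightarrow> E i \<in> events"
    and nb: "\<And>i. i \<in> A \<Longrightarrow> i \<in> nb i" "\<And>i. i \<in> A \<Longrightarrow> nb i \<subseteq> A"
    and indep: "\<And>i. i \<in> A \<Longrightarrow>
      indep_var (count_space UNIV) (\<lambda>\<omega>. of_bool (\<omega> \<in> E i) :: nat)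
        (count_space UNIV) (\<lambda>\<omega>. card {j \<in> A - nb i. \<omega> \<in> E j})"
  shows "\<bar>prob {\<omega> \<in> space M. \<forall>i\<in>A. \<omega> \<notin> E i} - exp (- (\<Sum>i\<in>A. prob (E i)))\<bar>
     \<le> (\<Sum>i\<in>A. \<Sum>j\<in>nb i. prob (E i) * prob (E j))
       + (\<Sum>i\<in>A. \<Sum>j\<in>nb i - {i}. prob (E i \<inter> E j))"
proof -
  note ev[measurable]
  define b1 where "b1 = (\<Sum>i\<in>A. \<Sum>j\<in>nb i. prob (E i) * prob (E j))"
  define b2 where "b2 = (\<Sum>i\<in>A. \<Sum>j\<in>nb i - {i}. prob (E i \<inter> E j))"
  define L where "L = (\<Sum>i\<in>A. prob (E i))"
  have L: "L \<ge> 0" by (auto simp: L_def intro!: sum_nonneg)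
  define F where "F s B \<omega> = (\<Prod>i\<in>B. 1 - s * indicator (E i) \<omega> :: real)" for s B \<omega>
  define W where "W \<omega> = card {i\<in>A. \<omega> \<in> E i}" for \<omega>
  define G where "G s = expectation (\<lambda>\<omega>. F s A \<omega>)" for s
  have F_meas [measurable]: "F s B \<in> borel_measurable M" if "B \<subseteq> A" for s B
  proof -
    have [measurable]: "E i \<in> events" if "i \<in> B" for i using that \<open>B \<subseteq> A\<close> ev by auto
    show ?thesis unfolding F_def by measurable
  qed
  have F_bds: "0 \<le> F s B \<omega>" "F s B \<omega> \<le> 1" if "s \<in> {0..1}" for s B \<omega>
    unfolding F_def using that by (auto intro!: prod_nonneg prod_le_1 simp: indicator_def)
  have F_int: "integrable M (F s B)" if "s \<in> {0..1}" "B \<subseteq> A" for s B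
    by (rule integrable_const_bound[of _ 1]) (use F_bds[OF that(1)] F_meas[OF that(2)] in auto)
  have IF_int: "integrable M (\<lambda>\<omega>. indicator (E i) \<omega> * F s B \<omega>)" if "s \<in> {0..1}" "B \<subseteq> A" "i \<in> A" for s B i
    using integrable_mult_indicator[OF ev[OF that(3)] F_int[OF that(1,2)]] by simp
  have F_lower: "1 - (\<Sum>j\<in>B. indicator (E j) \<omega>) \<le> F s B \<omega>" if "s \<in> {0..1}" for s B \<omega>
  proof -
    have "(\<Sum>j\<in>B. s * indicator (E j) \<omega>) \<le> (\<Sum>j\<in>B. indicator (E j) \<omega>)"
      using that by (intro sum_mono) (auto simp: indicator_def)
    moreover have "1 - (\<Sum>j\<in>B. s * indicator (E j) \<omega>) \<le> F s B \<omega>"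
      unfolding F_def using that by (intro Weierstrass_prod_ineq) (auto simp: indicator_def)
    ultimately show ?thesis by linarith
  qed
  have F_split: "F s A \<omega> = F s (A - B) \<omega> * F s B \<omega>" if "B \<subseteq> A" for s B \<omega>
    unfolding F_def using that fin by (intro prod.subset_diff)
  have W_le: "W \<omega> \<le> card A" for \<omega> unfolding W_def using fin by (intro card_mono) auto
  have W_meas [measurable]: "W \<in> measurable M (count_space UNIV)"
  proof -
    have "W = (\<lambda>\<omega>. \<Sum>i\<in>A. if \<omega> \<in> E i then 1 else 0)"
      using fin by (auto simp: W_def sum.If_cases Int_def)
    thus ?thesis by simp
  qed
  have G_deriv: "(G has_real_derivative
      - (\<Sum>i\<in>A. expectation (\<lambda>\<omega>. indicator (E i) \<omega> * F s (A - {i}) \<omega>))) (at s)"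
    if s: "s \<in> {0..1}" for s
  proof -
    have "(\<Sum>i\<in>A. expectation (\<lambda>\<omega>. indicator (E i) \<omega> * F s (A - {i}) \<omega>))
        = expectation (\<lambda>\<omega>. \<Sum>i\<in>A. indicator (E i) \<omega> * F s (A - {i}) \<omega>)"
      using s by (intro Bochner_Integration.integral_sum[symmetric] IF_int) auto
    also have "\<dots> = expectation (\<lambda>\<omega>. real (W \<omega>) * (1 - s) ^ (W \<omega> - 1))"
      by (simp add: F_def W_def sum_prod_thinned_indicators[OF fin])
    finally have sum_eq: "(\<Sum>i\<in>A. expectation (\<lambda>\<omega>. indicator (E i) \<omega> * F s (A - {i}) \<omega>))
        = expectation (\<lambda>\<omega>. real (W \<omega>) * (1 - s) ^ (W \<omega> - 1))" .
    have "G = (\<lambda>s. expectation (\<lambda>\<omega>. (1 - s) ^ W \<omega>))"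
      by (simp add: fun_eq_iff G_def F_def prod_thinned_indicators[OF fin] W_def)
    thus ?thesis
      unfolding sum_eq using expectation_power_has_derivative[OF W_meas W_le, of s] by simp
  qed
  \<comment> \<open>Both terms are compared with the product \<open>V\<close> over the events outside the neighbourhood of \<open>i\<close>,
      which is independent of \<open>E i\<close>. Dropping the factors of the neighbourhood costs at most the sum of
      their indicators, by the Weierstrass product inequality.\<close>
  have local_bound: "\<bar>prob (E i) * G s - expectation (\<lambda>\<omega>. indicator (E i) \<omega> * F s (A - {i}) \<omega>)\<bar>
      \<le> (\<Sum>j\<in>nb i. prob (E i) * prob (E j)) + (\<Sum>j\<in>nb i - {i}. prob (E i \<inter> E j))"
    if s: "s \<in> {0..1}" and i: "i \<in> A" for s i
  proof -
    define V where "V = F s (A - nb i)"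
    have nbA: "nb i \<subseteq> A" "finite (nb i)" using nb(2)[OF i] fin finite_subset by auto
    have V: "0 \<le> V \<omega>" "V \<omega> \<le> 1" for \<omega> using F_bds[OF s] by (auto simp: V_def)
    have V_int: "integrable M V" unfolding V_def using s by (intro F_int) auto
    have E_nb: "E j \<in> events" if "j \<in> nb i" for j using that nbA ev by auto
    have indep_V: "expectation (\<lambda>\<omega>. indicator (E i) \<omega> * V \<omega>) = prob (E i) * expectation V"
    proof -
      have "indep_var borel (real \<circ> (\<lambda>\<omega>. of_bool (\<omega> \<in> E i)))
          borel ((\<lambda>k. (1 - s) ^ k) \<circ> (\<lambda>\<omega>. card {j \<in> A - nb i. \<omega> \<in> E j}))"
        by (rule indep_var_compose[OF indep[OF i]]) auto
      moreover have "real \<circ> (\<lambda>\<omega>. of_bool (\<omega> \<in> E i)) = indicator (E i)"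
        by (auto simp: fun_eq_iff indicator_def)
      moreover have "(\<lambda>k. (1 - s) ^ k) \<circ> (\<lambda>\<omega>. card {j \<in> A - nb i. \<omega> \<in> E j}) = V"
        using fin by (auto simp: fun_eq_iff V_def F_def prod_thinned_indicators)
      ultimately have "indep_var borel (indicator (E i) :: 'a \<Rightarrow> real) borel V" by simp
      from indep_var_lebesgue_integral[OF this _ V_int] show ?thesis
        using ev[OF i] by (simp add: integrable_real_indicator less_top[symmetric])
    qed
    have "expectation V - G s = expectation (\<lambda>\<omega>. V \<omega> - F s A \<omega>)"
      unfolding G_def using V_int F_int[OF s, of A] by simp
    also have "\<dots> \<le> expectation (\<lambda>\<omega>. \<Sum>j\<in>nb i. indicator (E j) \<omega>)"
    proof (rule integral_mono)
      fix \<omega>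
      have "V \<omega> - F s A \<omega> = V \<omega> * (1 - F s (nb i) \<omega>)"
        unfolding V_def F_split[OF nbA(1)] by (simp add: algebra_simps)
      also have "\<dots> \<le> 1 * (1 - F s (nb i) \<omega>)"
        using V F_bds[OF s] by (intro mult_right_mono) auto
      also have "\<dots> \<le> (\<Sum>j\<in>nb i. indicator (E j) \<omega>)" using F_lower[OF s, of \<omega> "nb i"] by simp
      finally show "V \<omega> - F s A \<omega> \<le> (\<Sum>j\<in>nb i. indicator (E j) \<omega>)" .
    qed (use V_int F_int[OF s, of A] E_nb in \<open>auto simp: less_top[symmetric]\<close>)
    also have "\<dots> = (\<Sum>j\<in>nb i. prob (E j))"
      using E_nb by (subst Bochner_Integration.integral_sum) (auto simp: less_top[symmetric])
    finally have up1: "prob (E i) * (expectation V - G s) \<le> prob (E i) * (\<Sum>j\<in>nb i. prob (E j))"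
      by (intro mult_left_mono) auto
    have "G s \<le> expectation V" unfolding G_def
    proof (rule integral_mono)
      fix \<omega> show "F s A \<omega> \<le> V \<omega>"
        unfolding V_def F_split[OF nbA(1)] using F_bds[OF s] by (simp add: mult_left_le)
    qed (use V_int F_int[OF s, of A] in auto)
    hence lo1: "0 \<le> prob (E i) * (expectation V - G s)" by simp
    have F2: "F s (A - {i}) \<omega> = V \<omega> * F s (nb i - {i}) \<omega>" for \<omega>
    proof -
      have "nb i - {i} \<subseteq> A - {i}" "finite (A - {i})" "A - {i} - (nb i - {i}) = A - nb i"
        using nbA fin nb(1)[OF i] by auto
      thus ?thesis unfolding V_def F_def by (metis prod.subset_diff)
    qed
    let ?I = "\<lambda>\<omega>. indicator (E i) \<omega> :: real"
    have IV_int: "integrable M (\<lambda>\<omega>. ?I \<omega> * V \<omega>)" unfolding V_def using s i by (intro IF_int) auto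
    have IF2_int: "integrable M (\<lambda>\<omega>. ?I \<omega> * F s (A - {i}) \<omega>)" using s i by (intro IF_int) auto
    have "expectation (\<lambda>\<omega>. ?I \<omega> * V \<omega>) - expectation (\<lambda>\<omega>. ?I \<omega> * F s (A - {i}) \<omega>)
        = expectation (\<lambda>\<omega>. ?I \<omega> * V \<omega> - ?I \<omega> * F s (A - {i}) \<omega>)"
      using IV_int IF2_int by simp
    also have "\<dots> \<le> expectation (\<lambda>\<omega>. \<Sum>j\<in>nb i - {i}. indicator (E i \<inter> E j) \<omega>)"
    proof (rule integral_mono)
      fix \<omega>
      have "?I \<omega> * V \<omega> - ?I \<omega> * F s (A - {i}) \<omega> = ?I \<omega> * (V \<omega> * (1 - F s (nb i - {i}) \<omega>))"
        unfolding F2 by (simp add: algebra_simps)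
      also have "\<dots> \<le> ?I \<omega> * (1 * (1 - F s (nb i - {i}) \<omega>))"
        using V F_bds[OF s] by (intro mult_left_mono mult_right_mono) auto
      also have "\<dots> \<le> ?I \<omega> * (\<Sum>j\<in>nb i - {i}. indicator (E j) \<omega>)"
        using F_lower[OF s, of \<omega> "nb i - {i}"] by (intro mult_left_mono) auto
      also have "\<dots> = (\<Sum>j\<in>nb i - {i}. indicator (E i \<inter> E j) \<omega>)"
        by (simp add: sum_distrib_left indicator_inter_arith)
      finally show "?I \<omega> * V \<omega> - ?I \<omega> * F s (A - {i}) \<omega> \<le> (\<Sum>j\<in>nb i - {i}. indicator (E i \<inter> E j) \<omega>)" .
    qed (use IV_int IF2_int E_nb ev[OF i] in \<open>auto simp: less_top[symmetric]\<close>)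
    also have "\<dots> = (\<Sum>j\<in>nb i - {i}. prob (E i \<inter> E j))"
      using E_nb ev[OF i] by (subst Bochner_Integration.integral_sum) (auto simp: less_top[symmetric])
    finally have up2: "expectation (\<lambda>\<omega>. ?I \<omega> * V \<omega>) - expectation (\<lambda>\<omega>. ?I \<omega> * F s (A - {i}) \<omega>)
        \<le> (\<Sum>j\<in>nb i - {i}. prob (E i \<inter> E j))" .
    have lo2: "expectation (\<lambda>\<omega>. ?I \<omega> * F s (A - {i}) \<omega>) \<le> expectation (\<lambda>\<omega>. ?I \<omega> * V \<omega>)"
    proof (rule integral_mono)
      fix \<omega> show "?I \<omega> * F s (A - {i}) \<omega> \<le> ?I \<omega> * V \<omega>"
        unfolding F2 using F_bds[OF s] V by (intro mult_left_mono) (auto simp: mult_left_le)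
    qed (use IV_int IF2_int in auto)
    have "prob (E i) * (\<Sum>j\<in>nb i. prob (E j)) = (\<Sum>j\<in>nb i. prob (E i) * prob (E j))"
      by (simp add: sum_distrib_left)
    with up1 lo1 up2 lo2 show ?thesis unfolding indep_V by (simp add: right_diff_distrib abs_le_iff)
  qed
  define \<phi> where "\<phi> s = exp (L * s) * G s" for s
  define \<phi>' where "\<phi>' s = exp (L * s) * (\<Sum>i\<in>A. prob (E i) * G s
      - expectation (\<lambda>\<omega>. indicator (E i) \<omega> * F s (A - {i}) \<omega>))" for s
  have \<phi>_deriv: "(\<phi> has_real_derivative \<phi>' s) (at s)" if "s \<in> {0..1}" for s
    unfolding \<phi>_def \<phi>'_def
    by (auto intro!: derivative_eq_intros G_deriv[OF that]
        simp: L_def sum_subtractf sum_distrib_right sum_distrib_left algebra_simps)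
  have \<phi>'_le: "\<bar>\<phi>' s\<bar> \<le> exp L * (b1 + b2)" if s: "s \<in> {0..1}" for s
  proof -
    have "\<bar>\<Sum>i\<in>A. prob (E i) * G s - expectation (\<lambda>\<omega>. indicator (E i) \<omega> * F s (A - {i}) \<omega>)\<bar> \<le> b1 + b2"
      unfolding b1_def b2_def sum.distrib[symmetric]
      by (rule order_trans[OF sum_abs], rule sum_mono, rule local_bound[OF s])
    moreover have "exp (L * s) \<le> exp L" using s L by (simp add: mult_left_le)
    ultimately show ?thesis unfolding \<phi>'_def abs_mult by (intro mult_mono) auto
  qed
  have "\<exists>z::real. 0 < z \<and> z < 1 \<and> \<phi> 1 - \<phi> 0 = (1 - 0) * \<phi>' z"
    by (rule MVT2) (auto intro: \<phi>_deriv)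
  then obtain z :: real where "0 < z" "z < 1" "\<phi> 1 - \<phi> 0 = (1 - 0) * \<phi>' z"
    by (elim exE conjE)
  hence "z \<in> {0..1}" "\<phi> 1 - \<phi> 0 = \<phi>' z" by auto
  hence diff: "\<bar>\<phi> 1 - \<phi> 0\<bar> \<le> exp L * (b1 + b2)" using \<phi>'_le by auto
  have "\<phi> 0 = 1" by (simp add: \<phi>_def G_def F_def prob_space)
  moreover have "G 1 = prob {\<omega> \<in> space M. \<forall>i\<in>A. \<omega> \<notin> E i}"
  proof -
    have "G 1 = expectation (indicator {\<omega> \<in> space M. \<forall>i\<in>A. \<omega> \<notin> E i})"
      unfolding G_def
      by (rule Bochner_Integration.integral_cong[OF refl])
         (use fin in \<open>auto simp: F_def prod_zero_iff indicator_def intro!: prod.neutral\<close>)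
    also have "\<dots> = prob {\<omega> \<in> space M. \<forall>i\<in>A. \<omega> \<notin> E i}"
      by (simp add: Int_absorb2)
    finally show ?thesis .
  qed
  ultimately have "\<phi> 1 - \<phi> 0 = exp L * (prob {\<omega> \<in> space M. \<forall>i\<in>A. \<omega> \<notin> E i} - exp (- L))"
    by (simp add: \<phi>_def right_diff_distrib flip: exp_add)
  hence "exp L * \<bar>prob {\<omega> \<in> space M. \<forall>i\<in>A. \<omega> \<notin> E i} - exp (- L)\<bar> \<le> exp L * (b1 + b2)"
    using diff by (simp add: abs_mult)
  thus ?thesis by (simp add: b1_def b2_def L_def)
qed

end

section \<open>Large gcds in a uniform sample\<close>

lemma card_multiples_le:
  assumes "d \<ge> 1"
  shows "card ({x. d dvd x} \<inter> {1..N}) \<le> N div d"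
proof -
  have "{x. d dvd x} \<inter> {1..N} \<subseteq> (*) d ` {1..N div d}"
  proof
    fix x assume x: "x \<in> {x. d dvd x} \<inter> {1..N}"
    then obtain y where y: "x = d * y" by (auto elim: dvdE)
    hence "y \<in> {1..N div d}"
      using x assms by (auto simp: less_eq_div_iff_mult_less_eq mult.commute Suc_le_eq)
    thus "x \<in> (*) d ` {1..N div d}" using y by blast
  qed
  hence "card ({x. d dvd x} \<inter> {1..N}) \<le> card ((*) d ` {1..N div d})"
    by (intro card_mono) auto
  also have "\<dots> \<le> N div d" using card_image_le[of "{1..N div d}" "(*) d"] by simp
  finally show ?thesis .
qed

text \<open>Since \<open>1 / lcm d e = gcd d e / (d * e)\<close>, the summand is \<open>gcd d e / (d^2 * e^2)\<close>. Bounding \<open>gcd d e\<close> by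
the sum of all common divisors \<open>g\<close> separates \<open>d\<close> from \<open>e\<close>: each \<open>g\<close> contributes \<open>g\<close> times the square of
a sum over multiples of \<open>g\<close>, which is at most \<open>4 / (g * K^2)\<close>.\<close>

lemma sum_inverse_lcm_le:
  assumes "K \<ge> 1"
  shows "(\<Sum>d=K+1..N. \<Sum>e=K+1..N. 1 / (real (lcm d e) * real d * real e)) \<le> 4 * harm N / (real K)\<^sup>2"
proof -
  define D where "D = {K+1..N}"
  have "(\<Sum>d\<in>D. \<Sum>e\<in>D. 1 / (real (lcm d e) * real d * real e))
      \<le> (\<Sum>d\<in>D. \<Sum>e\<in>D. \<Sum>g=1..N. if g dvd d \<and> g dvd e then real g * (1 / (real d)\<^sup>2 * (1 / (real e)\<^sup>2)) else 0)"
  proof (intro sum_mono)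
    fix d e assume d: "d \<in> D" and e: "e \<in> D"
    hence pos: "d > 0" "e > 0" "gcd d e > 0" by (auto simp: D_def)
    have "real (gcd d e) * real (lcm d e) = real d * real e"
      by (metis of_nat_mult prod_gcd_lcm_nat)
    hence lcm: "1 / real (lcm d e) = real (gcd d e) / (real d * real e)"
      using pos by (simp add: field_simps)
    have "1 / (real (lcm d e) * real d * real e) = 1 / real (lcm d e) * (1 / (real d * real e))"
      by simp
    also have "\<dots> = real (gcd d e) / (real d * real e) * (1 / (real d * real e))"
      by (subst lcm) (rule refl)
    finally have "1 / (real (lcm d e) * real d * real e) = real (gcd d e) * (1 / (real d)\<^sup>2 * (1 / (real e)\<^sup>2))"
      by (simp add: power2_eq_square)
    also have "\<dots> = (\<Sum>g\<in>{gcd d e}. if g dvd d \<and> g dvd e then real g * (1 / (real d)\<^sup>2 * (1 / (real e)\<^sup>2)) else 0)"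
      by simp
    also have "\<dots> \<le> (\<Sum>g=1..N. if g dvd d \<and> g dvd e then real g * (1 / (real d)\<^sup>2 * (1 / (real e)\<^sup>2)) else 0)"
    proof (rule sum_mono2)
      have "gcd d e \<le> d" using pos by (intro gcd_le1_nat) simp
      moreover have "d \<le> N" using d by (simp add: D_def)
      ultimately have "gcd d e \<le> N" by linarith
      thus "{gcd d e} \<subseteq> {1..N}" using pos by (simp add: Suc_le_eq)
    qed auto
    finally show "1 / (real (lcm d e) * real d * real e)
        \<le> (\<Sum>g=1..N. if g dvd d \<and> g dvd e then real g * (1 / (real d)\<^sup>2 * (1 / (real e)\<^sup>2)) else 0)" .
  qed
  also have "\<dots> = (\<Sum>d\<in>D. \<Sum>g=1..N. \<Sum>e\<in>D. if g dvd d \<and> g dvd e then real g * (1 / (real d)\<^sup>2 * (1 / (real e)\<^sup>2)) else 0)"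
    by (intro sum.cong refl sum.swap)
  also have "\<dots> = (\<Sum>g=1..N. \<Sum>d\<in>D. \<Sum>e\<in>D. if g dvd d \<and> g dvd e then real g * (1 / (real d)\<^sup>2 * (1 / (real e)\<^sup>2)) else 0)"
    by (rule sum.swap)
  also have "\<dots> = (\<Sum>g=1..N. real g * (\<Sum>d | d \<in> D \<and> g dvd d. 1 / (real d)\<^sup>2)\<^sup>2)"
  proof (rule sum.cong[OF refl])
    fix g
    have D_fin: "finite D" by (simp add: D_def)
    have "(\<Sum>d\<in>D. \<Sum>e\<in>D. if g dvd d \<and> g dvd e then real g * (1 / (real d)\<^sup>2 * (1 / (real e)\<^sup>2)) else 0)
        = real g * ((\<Sum>d\<in>D. if g dvd d then 1 / (real d)\<^sup>2 else 0) * (\<Sum>e\<in>D. if g dvd e then 1 / (real e)\<^sup>2 else 0))"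
      unfolding sum_product unfolding sum_distrib_left by (intro sum.cong) auto
    also have "(\<Sum>d\<in>D. if g dvd d then 1 / (real d)\<^sup>2 else 0) = (\<Sum>d | d \<in> D \<and> g dvd d. 1 / (real d)\<^sup>2)"
      using D_fin by (simp add: sum.inter_filter)
    finally show "(\<Sum>d\<in>D. \<Sum>e\<in>D. if g dvd d \<and> g dvd e then real g * (1 / (real d)\<^sup>2 * (1 / (real e)\<^sup>2)) else 0)
        = real g * (\<Sum>d | d \<in> D \<and> g dvd d. 1 / (real d)\<^sup>2)\<^sup>2"
      by (simp add: power2_eq_square)
  qed
  also have "\<dots> \<le> (\<Sum>g=1..N. real g * (2 / (real g * real K))\<^sup>2)"
    unfolding D_def using assms
    by (intro sum_mono mult_left_mono power_mono sum_inverse_squares_multiples_le sum_nonneg) auto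
  also have "\<dots> = (\<Sum>g=1..N. 4 / (real K)\<^sup>2 * inverse (real g))"
    by (intro sum.cong) (auto simp: power2_eq_square field_simps)
  also have "\<dots> = 4 * harm N / (real K)\<^sup>2"
    by (simp add: harm_def sum_distrib_left sum_divide_distrib)
  finally show ?thesis by (simp add: D_def)
qed

locale uniform_sample = prob_space M for M :: "'a measure" +
  fixes X :: "nat \<Rightarrow> 'a \<Rightarrow> nat" and N :: nat
  assumes N_pos: "N \<ge> 1"
    and indep_X: "indep_vars (\<lambda>_. count_space UNIV) X {1..}"
    and uniform_X: "\<And>i. i \<ge> 1 \<Longrightarrow> distr M (count_space UNIV) (X i) = measure_pmf (pmf_of_set {1..N})"
begin

lemma X_measurable [measurable]: "i \<ge> 1 \<Longrightarrow> X i \<in> measurable M (count_space UNIV)"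
  using indep_X by (auto simp: indep_vars_def)

lemma prob_X_in:
  assumes "i \<ge> 1"
  shows "prob (X i -` S \<inter> space M) = real (card (S \<inter> {1..N})) / real N"
proof -
  have "prob (X i -` S \<inter> space M) = measure (distr M (count_space UNIV) (X i)) S"
    using X_measurable[OF assms] by (simp add: measure_distr)
  also have "\<dots> = real (card (S \<inter> {1..N})) / real N"
    unfolding uniform_X[OF assms] using N_pos
    by (subst measure_pmf_of_set) (auto simp: Int_commute)
  finally show ?thesis .
qed

lemma AE_X_in_range:
  assumes "i \<ge> 1"
  shows "AE \<omega> in M. X i \<omega> \<in> {1..N}"
proof (rule AE_prob_1[of "X i -` {1..N} \<inter> space M", THEN AE_mp])
  show "prob (X i -` {1..N} \<inter> space M) = 1" using prob_X_in[OF assms] N_pos by simp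
qed auto

text \<open>At most \<open>N div d\<close> of the numbers up to \<open>N\<close> are multiples of \<open>d\<close>; rounding only helps, so the bound
needs no error term.\<close>

lemma prob_X_dvd_le:
  assumes "i \<ge> 1" "d \<ge> 1"
  shows "prob (X i -` {x. d dvd x} \<inter> space M) \<le> 1 / real d"
proof -
  have "real (card ({x. d dvd x} \<inter> {1..N})) \<le> real (N div d)"
    using card_multiples_le[OF assms(2)] by simp
  also have "\<dots> \<le> real N / real d"
  proof -
    have "real (N div d * d) \<le> real N" by (simp del: of_nat_mult)
    thus ?thesis using assms by (simp add: pos_le_divide_eq)
  qed
  finally have "real (card ({x. d dvd x} \<inter> {1..N})) / real N \<le> real N / real d / real N"
    by (intro divide_right_mono) auto
  thus ?thesis unfolding prob_X_in[OF assms(1)] using N_pos by simp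
qed

lemma prob_X_all_in:
  assumes "J \<noteq> {}" "finite J" "J \<subseteq> {1..}"
  shows "prob (\<Inter>i\<in>J. X i -` S i \<inter> space M) = (\<Prod>i\<in>J. prob (X i -` S i \<inter> space M))"
  by (rule indep_varsD[OF indep_X assms]) auto

lemma prob_pair_in:
  assumes "i \<ge> 1" "j \<ge> 1" "i \<noteq> j" "S \<subseteq> {1..N} \<times> {1..N}"
  shows "prob {\<omega> \<in> space M. (X i \<omega>, X j \<omega>) \<in> S} = real (card S) / (real N)\<^sup>2"
proof -
  note [measurable] = X_measurable[OF assms(1)] X_measurable[OF assms(2)]
  have fin: "finite S" using assms(4) finite_subset by blast
  define Ev where "Ev p = {\<omega> \<in> space M. X i \<omega> = fst p \<and> X j \<omega> = snd p}" for p
  have Ev: "prob (Ev p) = 1 / (real N)\<^sup>2" if "p \<in> S" for p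
  proof -
    define T where "T k = (if k = i then {fst p} else {snd p})" for k
    have "Ev p = (\<Inter>k\<in>{i, j}. X k -` T k \<inter> space M)"
      using assms(3) by (auto simp: Ev_def T_def)
    also have "prob \<dots> = (\<Prod>k\<in>{i, j}. prob (X k -` T k \<inter> space M))"
      using assms by (intro prob_X_all_in) auto
    also have "\<dots> = 1 / (real N)\<^sup>2"
      using assms that by (auto simp: prob_X_in T_def power2_eq_square)
    finally show ?thesis .
  qed
  have "{\<omega> \<in> space M. (X i \<omega>, X j \<omega>) \<in> S} = (\<Union>p\<in>S. Ev p)" by (auto simp: Ev_def)
  also have "prob \<dots> = (\<Sum>p\<in>S. prob (Ev p))"
    using fin by (intro finite_measure_finite_Union) (auto simp: Ev_def disjoint_family_on_def)
  also have "\<dots> = real (card S) / (real N)\<^sup>2" using Ev by simp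
  finally show ?thesis .
qed

definition gcd_exceeds :: "nat \<Rightarrow> nat \<times> nat \<Rightarrow> 'a set" where
  "gcd_exceeds K p = {\<omega> \<in> space M. K < gcd (X (fst p) \<omega>) (X (snd p) \<omega>)}"

lemma gcd_exceeds_events: "a \<ge> 1 \<Longrightarrow> b \<ge> 1 \<Longrightarrow> gcd_exceeds K (a, b) \<in> events"
  unfolding gcd_exceeds_def fst_conv snd_conv using X_measurable[of a] X_measurable[of b] by measurable

lemma gcd_exceeds_swap: "gcd_exceeds K (a, b) = gcd_exceeds K (b, a)"
  by (simp add: gcd_exceeds_def gcd.commute)

lemma prob_gcd_exceeds:
  assumes "a \<ge> 1" "b \<ge> 1" "a \<noteq> b"
  shows "prob (gcd_exceeds K (a, b)) = (\<Sum>d=K+1..N. gcd_density N d)"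
proof -
  note [measurable] = X_measurable[OF assms(1)] X_measurable[OF assms(2)]
  define S where "S = (\<Union>d\<in>{K+1..N}. gcd_pairs N d)"
  have "prob (gcd_exceeds K (a, b)) = prob {\<omega> \<in> space M. (X a \<omega>, X b \<omega>) \<in> S}"
  proof (rule finite_measure_eq_AE)
    show "AE \<omega> in M. (\<omega> \<in> gcd_exceeds K (a, b)) = (\<omega> \<in> {\<omega> \<in> space M. (X a \<omega>, X b \<omega>) \<in> S})"
      using AE_X_in_range[OF assms(1)] AE_X_in_range[OF assms(2)] AE_space
    proof eventually_elim
      case (elim \<omega>)
      hence "gcd (X a \<omega>) (X b \<omega>) \<le> N" by (auto intro: order_trans[OF gcd_le1_nat])
      with elim show ?case by (auto simp: gcd_exceeds_def S_def gcd_pairs_def)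
    qed
    show "gcd_exceeds K (a, b) \<in> events" using assms by (simp add: gcd_exceeds_events)
    show "{\<omega> \<in> space M. (X a \<omega>, X b \<omega>) \<in> S} \<in> events" by measurable
  qed
  also have "\<dots> = real (card S) / (real N)\<^sup>2"
    using assms by (intro prob_pair_in) (auto simp: S_def gcd_pairs_def)
  also have "card S = (\<Sum>d=K+1..N. card (gcd_pairs N d))"
    unfolding S_def by (rule card_UN_disjoint) (simp, simp, auto simp: gcd_pairs_def)
  finally show ?thesis by (simp add: gcd_density_def sum_divide_distrib)
qed

text \<open>If the two gcds are \<open>d\<close> and \<open>e\<close>, then \<open>lcm d e\<close> divides \<open>X a\<close>, while \<open>d\<close> divides \<open>X b\<close> and \<open>e\<close>
divides \<open>X c\<close>. These three divisibilities are independent, so the union bound over \<open>d\<close> and \<open>e\<close>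
leads to the sum of \<open>1 / (lcm d e * d * e)\<close>.\<close>

lemma prob_two_gcds_exceed_le:
  assumes "a \<ge> 1" "b \<ge> 1" "c \<ge> 1" "a \<noteq> b" "a \<noteq> c" "b \<noteq> c" "K \<ge> 1"
  shows "prob (gcd_exceeds K (a, b) \<inter> gcd_exceeds K (a, c)) \<le> 4 * harm N / (real K)\<^sup>2"
proof -
  note [measurable] = X_measurable[OF assms(1)] X_measurable[OF assms(2)] X_measurable[OF assms(3)]
  define T where "T d e k = {x. (if k = a then lcm d e else if k = b then d else e) dvd x}"
    for d e k :: nat
  define Ev where "Ev d e = (\<Inter>k\<in>{a, b, c}. X k -` T d e k \<inter> space M)" for d e
  have Ev_events [measurable]: "Ev d e \<in> events" for d e
    unfolding Ev_def using assms
    by (intro sets.finite_INT measurable_sets[OF X_measurable]) auto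
  have "prob (gcd_exceeds K (a, b) \<inter> gcd_exceeds K (a, c))
      \<le> prob (\<Union>d\<in>{K+1..N}. \<Union>e\<in>{K+1..N}. Ev d e)"
  proof (rule finite_measure_mono_AE)
    show "AE \<omega> in M. \<omega> \<in> gcd_exceeds K (a, b) \<inter> gcd_exceeds K (a, c)
        \<longrightarrow> \<omega> \<in> (\<Union>d\<in>{K+1..N}. \<Union>e\<in>{K+1..N}. Ev d e)"
      using AE_X_in_range[OF assms(1)] AE_space
    proof eventually_elim
      case (elim \<omega>)
      show ?case
      proof
        assume \<omega>: "\<omega> \<in> gcd_exceeds K (a, b) \<inter> gcd_exceeds K (a, c)"
        define d e where "d = gcd (X a \<omega>) (X b \<omega>)" and "e = gcd (X a \<omega>) (X c \<omega>)"
        have "d \<le> X a \<omega>" "e \<le> X a \<omega>" using elim by (auto simp: d_def e_def intro!: gcd_le1_nat)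
        moreover have "K < d" "K < e" using \<omega> by (auto simp: gcd_exceeds_def d_def e_def)
        ultimately have "d \<in> {K+1..N}" "e \<in> {K+1..N}" using elim by auto
        moreover have "\<omega> \<in> Ev d e"
          using elim assms by (auto simp: Ev_def T_def d_def e_def)
        ultimately show "\<omega> \<in> (\<Union>d\<in>{K+1..N}. \<Union>e\<in>{K+1..N}. Ev d e)" by blast
      qed
    qed
  qed auto
  also have "\<dots> \<le> (\<Sum>d=K+1..N. prob (\<Union>e\<in>{K+1..N}. Ev d e))"
    by (rule finite_measure_subadditive_finite) auto
  also have "\<dots> \<le> (\<Sum>d=K+1..N. \<Sum>e=K+1..N. prob (Ev d e))"
    by (intro sum_mono finite_measure_subadditive_finite) auto
  also have "\<dots> \<le> (\<Sum>d=K+1..N. \<Sum>e=K+1..N. 1 / (real (lcm d e) * real d * real e))"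
  proof (intro sum_mono)
    fix d e assume de: "d \<in> {K+1..N}" "e \<in> {K+1..N}"
    have "prob (Ev d e) = (\<Prod>k\<in>{a, b, c}. prob (X k -` T d e k \<inter> space M))"
      unfolding Ev_def using assms by (intro prob_X_all_in) auto
    also have "\<dots> = prob (X a -` {x. lcm d e dvd x} \<inter> space M)
        * (prob (X b -` {x. d dvd x} \<inter> space M) * prob (X c -` {x. e dvd x} \<inter> space M))"
      using assms by (simp add: T_def)
    also have "\<dots> \<le> 1 / real (lcm d e) * (1 / real d * (1 / real e))"
      using assms de by (intro mult_mono prob_X_dvd_le) (auto simp: Suc_le_eq lcm_pos_nat)
    finally show "prob (Ev d e) \<le> 1 / (real (lcm d e) * real d * real e)" by simp
  qed
  also have "\<dots> \<le> 4 * harm N / (real K)\<^sup>2" by (rule sum_inverse_lcm_le) fact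
  finally show ?thesis .
qed

end

section \<open>Poisson approximation for the maximal gcd\<close>

lemma real_choose_2: "real (m choose 2) = real m * (real m - 1) / 2"
proof (induction m)
  case (Suc m)
  thus ?case by (simp add: numeral_2_eq_2 field_simps)
qed (simp add: numeral_2_eq_2)

definition pairs_upto :: "nat \<Rightarrow> (nat \<times> nat) set" where
  "pairs_upto m = {(i, j). 1 \<le> i \<and> i < j \<and> j \<le> m}"

lemma finite_pairs_upto [simp]: "finite (pairs_upto m)"
  by (rule finite_subset[of _ "{1..m} \<times> {1..m}"]) (auto simp: pairs_upto_def)

lemma card_pairs_upto: "card (pairs_upto m) = m choose 2"
proof -
  have "bij_betw (\<lambda>p. {fst p, snd p}) (pairs_upto m) {B. B \<subseteq> {1..m} \<and> card B = 2}"
  proof (rule bij_betw_imageI)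
    show "inj_on (\<lambda>p. {fst p, snd p}) (pairs_upto m)"
      by (auto simp: inj_on_def pairs_upto_def doubleton_eq_iff)
    show "(\<lambda>p. {fst p, snd p}) ` pairs_upto m = {B. B \<subseteq> {1..m} \<and> card B = 2}"
    proof (intro equalityI subsetI)
      fix B assume B: "B \<in> {B. B \<subseteq> {1..m} \<and> card B = 2}"
      then obtain x y where xy: "B = {x, y}" "x \<noteq> y" by (auto simp: card_2_iff)
      have "B = {min x y, max x y}" using xy by (auto simp: min_def max_def)
      moreover have "(min x y, max x y) \<in> pairs_upto m"
        using B xy by (auto simp: pairs_upto_def min_def max_def)
      ultimately show "B \<in> (\<lambda>p. {fst p, snd p}) ` pairs_upto m" by force
    qed (auto simp: pairs_upto_def)
  qed
  hence "card (pairs_upto m) = card {B. B \<subseteq> {1..m} \<and> card B = 2}" by (rule bij_betw_same_card)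
  also have "\<dots> = m choose 2" by (subst n_subsets) auto
  finally show ?thesis .
qed

definition overlapping_pairs :: "nat \<Rightarrow> nat \<times> nat \<Rightarrow> (nat \<times> nat) set" where
  "overlapping_pairs m p = {q \<in> pairs_upto m. {fst p, snd p} \<inter> {fst q, snd q} \<noteq> {}}"

lemma card_overlapping_pairs_le: "card (overlapping_pairs m p) \<le> 4 * m"
proof -
  obtain a b where p: "p = (a, b)" by force
  let ?S = "(\<lambda>k. (a, k)) ` {1..m} \<union> (\<lambda>k. (k, a)) ` {1..m} \<union> (\<lambda>k. (b, k)) ` {1..m} \<union> (\<lambda>k. (k, b)) ` {1..m}"
  have "card (overlapping_pairs m p) \<le> card ?S"
    by (rule card_mono) (auto simp: overlapping_pairs_def pairs_upto_def p)
  also have "\<dots> \<le> m + m + m + m"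
    by (intro order_trans[OF card_Un_le] add_mono order_trans[OF card_image_le]) auto
  finally show ?thesis by simp
qed

lemma max_gcd_le_iff:
  assumes "m \<ge> 2"
  shows "max_gcd X m \<omega> \<le> K \<longleftrightarrow> (\<forall>p\<in>pairs_upto m. gcd (X (fst p) \<omega>) (X (snd p) \<omega>) \<le> K)"
proof -
  let ?S = "(\<lambda>p. gcd (X (fst p) \<omega>) (X (snd p) \<omega>)) ` pairs_upto m"
  have "max_gcd X m \<omega> = Max ?S"
    unfolding max_gcd_def by (rule arg_cong[of _ _ Max]) (force simp: pairs_upto_def)
  moreover have "(1, 2) \<in> pairs_upto m" using assms by (simp add: pairs_upto_def)
  hence "?S \<noteq> {}" by blast
  ultimately show ?thesis by simp
qed

text \<open>The event \<open>gcd_exceeds K p\<close> lies in the sample space, while the random variables are unconstrained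
outside of it; hence functions must be replaced by functions that agree on the space only.\<close>

lemma (in prob_space) indep_var_cong_space:
  assumes indep: "indep_var MA A MB B"
    and eq: "\<And>\<omega>. \<omega> \<in> space M \<Longrightarrow> A \<omega> = A' \<omega>" "\<And>\<omega>. \<omega> \<in> space M \<Longrightarrow> B \<omega> = B' \<omega>"
  shows "indep_var MA A' MB B'"
proof -
  have *: "case_bool A B i \<omega> = case_bool A' B' i \<omega>" if "\<omega> \<in> space M" for i \<omega>
    using eq that by (cases i) auto
  have "case_bool A B i \<in> measurable M (case_bool MA MB i)
      \<longleftrightarrow> case_bool A' B' i \<in> measurable M (case_bool MA MB i)" for i
    using * by (intro measurable_cong) auto
  moreover have "case_bool A B i -` S \<inter> space M = case_bool A' B' i -` S \<inter> space M" for i S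
    using * by auto
  ultimately show ?thesis using indep unfolding indep_var_def indep_vars_def2 by simp
qed

lemma measurable_gcd_exceeds:
  fixes u v :: "'b \<Rightarrow> nat"
  assumes [measurable]: "u \<in> measurable L (count_space UNIV)" "v \<in> measurable L (count_space UNIV)"
  shows "(\<lambda>x. of_bool (K < gcd (u x) (v x)) :: nat) \<in> measurable L (count_space UNIV)"
  by measurable

lemma measurable_sum_nat:
  fixes f :: "'i \<Rightarrow> 'b \<Rightarrow> nat"
  assumes [measurable]: "\<And>i. i \<in> I \<Longrightarrow> f i \<in> measurable L (count_space UNIV)"
  shows "(\<lambda>x. \<Sum>i\<in>I. f i x) \<in> measurable L (count_space UNIV)"
  by measurable

context uniform_sample
begin

text \<open>The left variable depends on \<open>X a\<close> and \<open>X b\<close>, where \<open>p = (a, b)\<close>, and the right one on the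
other members of the sample.\<close>

lemma gcd_exceeds_indep:
  assumes "p \<in> pairs_upto m"
  shows "indep_var (count_space UNIV) (\<lambda>\<omega>. of_bool (\<omega> \<in> gcd_exceeds K p) :: nat)
    (count_space UNIV) (\<lambda>\<omega>. card {q \<in> pairs_upto m - overlapping_pairs m p. \<omega> \<in> gcd_exceeds K q})"
proof -
  obtain a b where p: "p = (a, b)" by force
  define J where "J = {1..m} - {a, b}"
  define Q where "Q = pairs_upto m - overlapping_pairs m p"
  have ab: "1 \<le> a" "a < b" "b \<le> m" using assms by (auto simp: p pairs_upto_def)
  have QJ: "fst q \<in> J" "snd q \<in> J" if "q \<in> Q" for q
    using that by (auto simp: Q_def J_def overlapping_pairs_def pairs_upto_def p)
  have Q_fin: "finite Q" by (simp add: Q_def)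
  let ?S = "\<lambda>I. PiM I (\<lambda>_::nat. count_space (UNIV :: nat set))"
  define f :: "(nat \<Rightarrow> nat) \<Rightarrow> nat" where "f x = of_bool (K < gcd (x a) (x b))" for x
  define g :: "(nat \<Rightarrow> nat) \<Rightarrow> nat" where "g x = (\<Sum>q\<in>Q. of_bool (K < gcd (x (fst q)) (x (snd q))))" for x
  have comp: "(\<lambda>x. x i) \<in> measurable (?S I) (count_space UNIV)" if "i \<in> I" for i I
    using that by (rule measurable_component_singleton)
  have f_meas: "f \<in> measurable (?S {a, b}) (count_space UNIV)"
    unfolding f_def by (intro measurable_gcd_exceeds comp) auto
  have g_meas: "g \<in> measurable (?S J) (count_space UNIV)"
    unfolding g_def using QJ by (intro measurable_sum_nat measurable_gcd_exceeds comp) auto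
  have "indep_var (?S {a, b}) (\<lambda>\<omega>. restrict (\<lambda>i. X i \<omega>) {a, b}) (?S J) (\<lambda>\<omega>. restrict (\<lambda>i. X i \<omega>) J)"
    using ab by (intro indep_var_restrict[OF indep_X]) (auto simp: J_def)
  from indep_var_compose[OF this f_meas g_meas]
  show ?thesis
  proof (rule indep_var_cong_space)
    fix \<omega> assume \<omega>: "\<omega> \<in> space M"
    thus "(f \<circ> (\<lambda>\<omega>. restrict (\<lambda>i. X i \<omega>) {a, b})) \<omega> = of_bool (\<omega> \<in> gcd_exceeds K p)"
      by (simp add: f_def gcd_exceeds_def p)
    have "g (restrict (\<lambda>i. X i \<omega>) J) = (\<Sum>q\<in>Q. of_bool (\<omega> \<in> gcd_exceeds K q))"
      unfolding g_def using QJ \<omega> by (intro sum.cong) (auto simp: gcd_exceeds_def)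
    also have "\<dots> = card {q \<in> Q. \<omega> \<in> gcd_exceeds K q}"
      using Q_fin by (simp add: Int_def)
    finally show "(g \<circ> (\<lambda>\<omega>. restrict (\<lambda>i. X i \<omega>) J)) \<omega>
        = card {q \<in> pairs_upto m - overlapping_pairs m p. \<omega> \<in> gcd_exceeds K q}"
      by (simp add: Q_def)
  qed
qed

text \<open>Two different pairs that overlap have exactly one index in common; up to the order of the entries,
they have the form \<open>(x, y)\<close> and \<open>(x, z)\<close>.\<close>

lemma prob_overlapping_gcds_exceed_le:
  assumes p: "p \<in> pairs_upto m" and q: "q \<in> overlapping_pairs m p" "q \<noteq> p" and K: "K \<ge> 1"
  shows "prob (gcd_exceeds K p \<inter> gcd_exceeds K q) \<le> 4 * harm N / (real K)\<^sup>2"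
proof -
  obtain a b where ab: "p = (a, b)" by force
  obtain c d where cd: "q = (c, d)" by force
  have 1: "1 \<le> a" "a < b" "1 \<le> c" "c < d"
    using p q by (auto simp: ab cd overlapping_pairs_def pairs_upto_def)
  have "a = c \<or> a = d \<or> b = c \<or> b = d" "\<not> (a = c \<and> b = d)"
    using q by (auto simp: ab cd overlapping_pairs_def)
  then consider "a = c" "b \<noteq> d" | "a = d" | "b = c" | "b = d" "a \<noteq> c" by blast
  thus ?thesis
  proof cases
    case 1
    thus ?thesis using prob_two_gcds_exceed_le[of a b d K] \<open>1 \<le> a\<close> \<open>a < b\<close> \<open>c < d\<close> K
      by (simp add: ab cd)
  next
    case 2
    thus ?thesis using prob_two_gcds_exceed_le[of a b c K] 1 K
      by (simp add: ab cd gcd_exceeds_swap[of K c])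
  next
    case 3
    thus ?thesis using prob_two_gcds_exceed_le[of b a d K] 1 K
      by (simp add: ab cd gcd_exceeds_swap[of K a])
  next
    case 4
    thus ?thesis using prob_two_gcds_exceed_le[of b a c K] \<open>1 \<le> a\<close> \<open>a < b\<close> \<open>c < d\<close> \<open>1 \<le> c\<close> K
      by (simp add: ab cd gcd_exceeds_swap[of K a] gcd_exceeds_swap[of K c])
  qed
qed

text \<open>Each of the at most \<open>m^2 / 2\<close> pairs overlaps at most \<open>4 * m\<close> pairs. A neighbour contributes at
most \<open>1 / K^2\<close> to the product of the two probabilities and at most \<open>4 * harm N / K^2\<close> to the
probability of the intersection.\<close>

theorem prob_max_gcd_le_approx:
  assumes m: "m \<ge> 2" and K: "K \<ge> 1"
  shows "\<bar>prob {\<omega> \<in> space M. max_gcd X m \<omega> \<le> K}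
      - exp (- (real (m choose 2) * (\<Sum>d=K+1..N. gcd_density N d)))\<bar>
    \<le> 8 * real m ^ 3 * (1 + harm N) / (real K)\<^sup>2"
proof -
  define \<pi> where "\<pi> = (\<Sum>d=K+1..N. gcd_density N d)"
  have pi: "0 \<le> \<pi>" by (auto simp: \<pi>_def gcd_density_def intro!: sum_nonneg)
  have "\<pi> \<le> (\<Sum>d=K+1..N. 1 / (real d)\<^sup>2)" unfolding \<pi>_def
  proof (rule sum_mono)
    fix d assume "d \<in> {K+1..N}"
    thus "gcd_density N d \<le> 1 / (real d)\<^sup>2"
      using gcd_density_bounds[of d N] by (simp add: pos_le_divide_eq mult.commute)
  qed
  also have "\<dots> \<le> 1 / real K" using K by (rule sum_inverse_squares_le)
  finally have pi_le: "\<pi> \<le> 1 / real K" .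
  have prob_p: "prob (gcd_exceeds K p) = \<pi>" if "p \<in> pairs_upto m" for p
    using that prob_gcd_exceeds[of "fst p" "snd p" K] by (auto simp: pairs_upto_def \<pi>_def)
  have sub: "overlapping_pairs m p \<subseteq> pairs_upto m" for p by (auto simp: overlapping_pairs_def)
  have harm: "harm N \<ge> (0::real)" by (rule harm_nonneg)
  have card_le: "real (card (overlapping_pairs m p)) \<le> 4 * real m" for p
    using card_overlapping_pairs_le[of m p] by linarith
  have "\<bar>prob {\<omega> \<in> space M. \<forall>p\<in>pairs_upto m. \<omega> \<notin> gcd_exceeds K p}
       - exp (- (\<Sum>p\<in>pairs_upto m. prob (gcd_exceeds K p)))\<bar>
     \<le> (\<Sum>p\<in>pairs_upto m. \<Sum>q\<in>overlapping_pairs m p. prob (gcd_exceeds K p) * prob (gcd_exceeds K q))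
       + (\<Sum>p\<in>pairs_upto m. \<Sum>q\<in>overlapping_pairs m p - {p}. prob (gcd_exceeds K p \<inter> gcd_exceeds K q))"
  proof (rule prob_none_poisson_approx)
    fix p assume p: "p \<in> pairs_upto m"
    show "gcd_exceeds K p \<in> events"
      using p gcd_exceeds_events[of "fst p" "snd p" K] by (auto simp: pairs_upto_def)
    show "p \<in> overlapping_pairs m p" using p by (auto simp: overlapping_pairs_def)
  qed (use sub gcd_exceeds_indep in auto)
  also have "\<dots> \<le> (\<Sum>p\<in>pairs_upto m. 4 * real m * (1 / (real K)\<^sup>2))
       + (\<Sum>p\<in>pairs_upto m. 4 * real m * (4 * harm N / (real K)\<^sup>2))"
  proof (intro add_mono sum_mono)
    fix p assume p: "p \<in> pairs_upto m"
    have "(\<Sum>q\<in>overlapping_pairs m p. prob (gcd_exceeds K p) * prob (gcd_exceeds K q))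
        = (\<Sum>q\<in>overlapping_pairs m p. \<pi> * \<pi>)"
      using p sub[of p] by (intro sum.cong) (auto simp: prob_p subsetD)
    also have "\<dots> = real (card (overlapping_pairs m p)) * \<pi>\<^sup>2"
      by (simp add: power2_eq_square)
    also have "\<dots> \<le> 4 * real m * (1 / real K)\<^sup>2"
      using pi pi_le card_le by (intro mult_mono power_mono) auto
    finally show "(\<Sum>q\<in>overlapping_pairs m p. prob (gcd_exceeds K p) * prob (gcd_exceeds K q))
        \<le> 4 * real m * (1 / (real K)\<^sup>2)" by (simp add: power_divide)
    have "(\<Sum>q\<in>overlapping_pairs m p - {p}. prob (gcd_exceeds K p \<inter> gcd_exceeds K q))
        \<le> real (card (overlapping_pairs m p - {p})) * (4 * harm N / (real K)\<^sup>2)"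
      using p K by (intro sum_bounded_above prob_overlapping_gcds_exceed_le) auto
    also have "\<dots> \<le> 4 * real m * (4 * harm N / (real K)\<^sup>2)"
    proof (intro mult_right_mono)
      have "card (overlapping_pairs m p - {p}) \<le> card (overlapping_pairs m p)"
        using finite_subset[OF sub finite_pairs_upto] by (intro card_mono) auto
      thus "real (card (overlapping_pairs m p - {p})) \<le> 4 * real m"
        using card_le[of p] by linarith
    qed (use harm in auto)
    finally show "(\<Sum>q\<in>overlapping_pairs m p - {p}. prob (gcd_exceeds K p \<inter> gcd_exceeds K q))
        \<le> 4 * real m * (4 * harm N / (real K)\<^sup>2)" .
  qed
  also have "\<dots> = real (m choose 2) * (4 * real m * ((1 + 4 * harm N) / (real K)\<^sup>2))"
    by (simp add: card_pairs_upto algebra_simps add_divide_distrib)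
  also have "\<dots> \<le> real m ^ 2 / 2 * (4 * real m * (4 * (1 + harm N) / (real K)\<^sup>2))"
  proof (intro mult_mono mult_left_mono divide_right_mono)
    show "real (m choose 2) \<le> real m ^ 2 / 2"
      by (simp add: real_choose_2 power2_eq_square algebra_simps)
  qed (use harm in auto)
  also have "\<dots> = 8 * real m ^ 3 * (1 + harm N) / (real K)\<^sup>2"
    by (simp add: power2_eq_square power3_eq_cube)
  also have "{\<omega> \<in> space M. \<forall>p\<in>pairs_upto m. \<omega> \<notin> gcd_exceeds K p} = {\<omega> \<in> space M. max_gcd X m \<omega> \<le> K}"
    by (auto simp: max_gcd_le_iff[OF m] gcd_exceeds_def not_less)
  also have "(\<Sum>p\<in>pairs_upto m. prob (gcd_exceeds K p)) = real (m choose 2) * \<pi>"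
    using prob_p by (simp add: card_pairs_upto)
  finally show ?thesis by (simp add: \<pi>_def)
qed

end

lemma measurable_max_gcd:
  assumes "m \<ge> 2" "\<And>i. i \<ge> 1 \<Longrightarrow> X i \<in> measurable M (count_space UNIV)"
  shows "max_gcd X m \<in> measurable M (count_space UNIV)"
proof -
  have "{\<omega> \<in> space M. max_gcd X m \<omega> \<le> K} \<in> sets M" for K
  proof -
    have "{\<omega> \<in> space M. gcd (X (fst p) \<omega>) (X (snd p) \<omega>) \<le> K} \<in> sets M" if "p \<in> pairs_upto m" for p
    proof -
      have [measurable]: "X (fst p) \<in> measurable M (count_space UNIV)" "X (snd p) \<in> measurable M (count_space UNIV)"
        using that assms(2) by (auto simp: pairs_upto_def)
      show ?thesis by measurable
    qed
    thus ?thesis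
      unfolding max_gcd_le_iff[OF assms(1)] by (intro sets.sets_Collect_finite_All) auto
  qed
  hence "max_gcd X m \<in> borel_measurable M" by (rule borel_measurableI_le)
  also have "borel_measurable M = measurable M (count_space (UNIV :: nat set))"
    by (intro measurable_cong_sets refl) (simp add: sets_borel_eq_count_space)
  finally show ?thesis .
qed

section \<open>The limit law\<close>

lemma harm_le_1_plus_ln:
  assumes "n \<ge> 1"
  shows "harm n \<le> 1 + ln (real n)"
  using euler_mascheroni_sequence_decreasing[of 1 n] assms by (simp add: harm_def)

lemma floor_ratio_tendsto:
  fixes C :: "nat \<Rightarrow> real"
  assumes C: "filterlim C at_top sequentially" and t: "t > 0"
  shows "(\<lambda>m. real (nat \<lfloor>t * C m\<rfloor>) / C m) \<longlonglongrightarrow> t"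
proof (rule tendsto_sandwich)
  have ev: "\<forall>\<^sub>F m in sequentially. C m > 0"
    using C by (auto simp: filterlim_at_top_dense)
  show "\<forall>\<^sub>F m in sequentially. t - 1 / C m \<le> real (nat \<lfloor>t * C m\<rfloor>) / C m"
    using ev
  proof eventually_elim
    case (elim m)
    have "t * C m - 1 \<le> real (nat \<lfloor>t * C m\<rfloor>)" by linarith
    hence "(t * C m - 1) / C m \<le> real (nat \<lfloor>t * C m\<rfloor>) / C m"
      using elim by (intro divide_right_mono) auto
    thus ?case using elim by (simp add: diff_divide_distrib)
  qed
  show "\<forall>\<^sub>F m in sequentially. real (nat \<lfloor>t * C m\<rfloor>) / C m \<le> t"
    using ev
  proof eventually_elim
    case (elim m)
    have "0 \<le> t * C m" using elim t by simp
    hence "real (nat \<lfloor>t * C m\<rfloor>) \<le> t * C m" by linarith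
    thus ?case using elim by (simp add: divide_le_eq)
  qed
  have "(\<lambda>m. t - inverse (C m)) \<longlonglongrightarrow> t - 0"
    by (intro tendsto_intros tendsto_inverse_0_at_top C)
  thus "(\<lambda>m. t - 1 / C m) \<longlonglongrightarrow> t" by (simp add: inverse_eq_divide)
qed simp

lemma choose_2_at_top: "filterlim (\<lambda>m. real (m choose 2)) at_top sequentially"
  unfolding real_choose_2 by real_asymp

lemma choose_2_pos: "m \<ge> 2 \<Longrightarrow> real (m choose 2) > 0"
  by (simp add: real_choose_2)

lemma scaled_max_gcd_le_iff:
  assumes "m \<ge> 2" "t > 0"
  shows "scaled_max_gcd X m \<omega> \<le> t \<longleftrightarrow> max_gcd X m \<omega> \<le> nat \<lfloor>t * real (m choose 2)\<rfloor>"
proof -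
  have pos: "real (m choose 2) > 0" using assms by (intro choose_2_pos)
  have "scaled_max_gcd X m \<omega> \<le> t \<longleftrightarrow> real (max_gcd X m \<omega>) \<le> t * real (m choose 2)"
    using pos by (simp add: scaled_max_gcd_def pos_divide_le_eq)
  also have "\<dots> \<longleftrightarrow> max_gcd X m \<omega> \<le> nat \<lfloor>t * real (m choose 2)\<rfloor>"
    using pos assms by (simp add: le_nat_iff le_floor_iff)
  finally show ?thesis .
qed

theorem theorem3:
  fixes P :: "nat \<Rightarrow> 'a measure"
    and X :: "nat \<Rightarrow> nat \<Rightarrow> 'a \<Rightarrow> nat"
    and \<beta> \<gamma> :: real
    and n :: "nat \<Rightarrow> nat"
  assumes prob: "\<And>N. N \<ge> 1 \<Longrightarrow> prob_space (P N)"
    and indep: "\<And>N. N \<ge> 1 \<Longrightarrow>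
      prob_space.indep_vars (P N) (\<lambda>_. count_space UNIV) (X N) {1..}"
    and uniform: "\<And>N i. N \<ge> 1 \<Longrightarrow> i \<ge> 1 \<Longrightarrow>
      distr (P N) (count_space UNIV) (X N i) = measure_pmf (pmf_of_set {1..N})"
    and beta: "\<beta> > 2"
    and gamma: "\<gamma> < 1 / 3"
    and n_pos: "\<And>m. n m \<ge> 1"
    and n_bounds: "\<forall>\<^sub>F m in sequentially.
      real m powr \<beta> \<le> real (n m) \<and> real (n m) \<le> exp (real m powr \<gamma>)"
  shows "(\<forall>t>0. (\<lambda>m. measure (P (n m)) {\<omega> \<in> space (P (n m)). scaled_max_gcd (X (n m)) m \<omega> \<le> t})
            \<longlonglongrightarrow> exp (- 1 / (t * zeta 2)))
       \<and> weak_conv_m (\<lambda>m. distr (P (n m)) borel (scaled_max_gcd (X (n m)) m))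
           (frechet_distribution (1 / zeta 2))"
proof -
  have sample: "uniform_sample (P (n m)) (X (n m)) (n m)" for m
    using prob[OF n_pos] indep[OF n_pos] uniform[OF n_pos] n_pos[of m]
    by (intro uniform_sample.intro uniform_sample_axioms.intro) auto
  define prb where "prb t m = measure (P (n m)) {\<omega> \<in> space (P (n m)). scaled_max_gcd (X (n m)) m \<omega> \<le> t}" for t m
  have prb_lim: "prb t \<longlonglongrightarrow> exp (- 1 / (t * zeta 2))" if t: "t > 0" for t
  proof -
    define C where "C m = real (m choose 2)" for m
    define K where "K m = nat \<lfloor>t * C m\<rfloor>" for m
    define S where "S m = (\<Sum>d=K m + 1..n m. gcd_density (n m) d)" for m
    have KC: "(\<lambda>m. real (K m) / C m) \<longlonglongrightarrow> t"
      unfolding K_def C_def by (intro floor_ratio_tendsto choose_2_at_top t)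
    have CK: "(\<lambda>m. C m / real (K m)) \<longlonglongrightarrow> 1 / t"
      using tendsto_inverse[OF KC] t by (simp add: inverse_eq_divide)
    have K_top: "filterlim K at_top sequentially"
    proof -
      have "filterlim (\<lambda>m. t * C m) at_top sequentially"
        unfolding C_def by (rule filterlim_tendsto_pos_mult_at_top[OF tendsto_const t choose_2_at_top])
      hence "filterlim (\<lambda>m. nat \<lfloor>t * C m\<rfloor>) at_top sequentially"
        by (rule filterlim_compose[OF filterlim_compose[OF filterlim_nat_sequentially filterlim_floor_sequentially]])
      thus ?thesis by (simp add: K_def[abs_def])
    qed
    have ev_K: "\<forall>\<^sub>F m in sequentially. K m \<ge> 1" using K_top by (auto simp: filterlim_at_top)
    have Kn: "(\<lambda>m. real (K m) / real (n m)) \<longlonglongrightarrow> 0"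
    proof (rule tendsto_sandwich[OF _ _ tendsto_const])
      show "\<forall>\<^sub>F m in sequentially. real (K m) / real (n m) \<le> t * real m powr (2 - \<beta>)"
        using n_bounds eventually_gt_at_top[of 0]
      proof eventually_elim
        case (elim m)
        have "0 \<le> t * C m" using t by (simp add: C_def)
        hence "real (K m) \<le> t * C m" unfolding K_def by linarith
        also have "C m \<le> real m powr 2" using elim
          by (simp add: C_def real_choose_2 power2_eq_square algebra_simps)
        finally have "real (K m) \<le> t * real m powr 2" using t by simp
        hence "real (K m) / real (n m) \<le> t * real m powr 2 / real m powr \<beta>"
          using elim t by (intro frac_le) auto
        thus ?case by (simp add: powr_diff)
      qed
      have "(\<lambda>m. real m powr (2 - \<beta>)) \<longlonglongrightarrow> 0"
        using beta by (intro tendsto_neg_powr filterlim_real_sequentially) auto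
      from tendsto_mult_right_zero[OF this] show "(\<lambda>m. t * real m powr (2 - \<beta>)) \<longlonglongrightarrow> 0" .
    qed auto
    have "(\<lambda>m. real (K m) * S m) \<longlonglongrightarrow> 1 / zeta 2"
      unfolding S_def by (intro sum_gcd_density_tail_asymptotics K_top Kn n_pos)
    from tendsto_mult[OF CK this]
    have "(\<lambda>m. C m / real (K m) * (real (K m) * S m)) \<longlonglongrightarrow> 1 / (t * zeta 2)" by simp
    moreover have "\<forall>\<^sub>F m in sequentially. C m / real (K m) * (real (K m) * S m) = C m * S m"
      using ev_K by eventually_elim auto
    ultimately have rate: "(\<lambda>m. C m * S m) \<longlonglongrightarrow> 1 / (t * zeta 2)" by (rule Lim_transform_eventually)
    have poisson: "(\<lambda>m. exp (- (C m * S m))) \<longlonglongrightarrow> exp (- (1 / (t * zeta 2)))"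
      by (intro tendsto_intros rate)
    \<comment> \<open>As \<open>C m\<close> is of order \<open>m^2\<close>, this term is at most of order \<open>m powr (1 / 3 - 1)\<close>; it bounds the error of the
        Poisson approximation because \<open>K m\<close> and \<open>C m\<close> are proportional in the limit.\<close>
    have "(\<lambda>m. 8 * real m ^ 3 * (1 + harm (n m)) / (C m)\<^sup>2) \<longlonglongrightarrow> 0"
    proof (rule tendsto_sandwich[OF _ _ tendsto_const])
      show "\<forall>\<^sub>F m in sequentially. 0 \<le> 8 * real m ^ 3 * (1 + harm (n m)) / (C m)\<^sup>2"
        by (intro always_eventually allI divide_nonneg_nonneg mult_nonneg_nonneg add_nonneg_nonneg harm_nonneg) auto
      show "\<forall>\<^sub>F m in sequentially. 8 * real m ^ 3 * (1 + harm (n m)) / (C m)\<^sup>2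
          \<le> 8 * real m ^ 3 * (2 + real m powr (1 / 3)) / (real m * (real m - 1) / 2)\<^sup>2"
        using n_bounds eventually_ge_at_top[of 1]
      proof eventually_elim
        case (elim m)
        have "ln (real (n m)) \<le> ln (exp (real m powr \<gamma>))"
          using elim n_pos[of m] by (subst ln_le_cancel_iff) auto
        also have "\<dots> \<le> real m powr (1 / 3)" using elim gamma by (simp add: powr_mono)
        finally have "1 + harm (n m) \<le> 2 + real m powr (1 / 3)"
          using harm_le_1_plus_ln[OF n_pos[of m]] by linarith
        thus ?case unfolding C_def real_choose_2 by (intro divide_right_mono mult_left_mono) auto
      qed
      show "(\<lambda>m. 8 * real m ^ 3 * (2 + real m powr (1 / 3)) / (real m * (real m - 1) / 2)\<^sup>2) \<longlonglongrightarrow> 0"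
        by real_asymp
    qed
    from tendsto_mult[OF this tendsto_power[OF CK, of 2]]
    have "(\<lambda>m. 8 * real m ^ 3 * (1 + harm (n m)) / (C m)\<^sup>2 * (C m / real (K m))\<^sup>2) \<longlonglongrightarrow> 0" by simp
    moreover have "\<forall>\<^sub>F m in sequentially. norm (prb t m - exp (- (C m * S m)))
        \<le> 8 * real m ^ 3 * (1 + harm (n m)) / (C m)\<^sup>2 * (C m / real (K m))\<^sup>2"
      using ev_K eventually_ge_at_top[of 2]
    proof eventually_elim
      case (elim m)
      have "C m > 0" using elim by (simp add: C_def choose_2_pos)
      hence "8 * real m ^ 3 * (1 + harm (n m)) / (C m)\<^sup>2 * (C m / real (K m))\<^sup>2
          = 8 * real m ^ 3 * (1 + harm (n m)) / (real (K m))\<^sup>2"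
        by (simp add: power_divide)
      moreover have "prb t m = measure (P (n m)) {\<omega> \<in> space (P (n m)). max_gcd (X (n m)) m \<omega> \<le> K m}"
        unfolding prb_def K_def C_def using elim t by (simp add: scaled_max_gcd_le_iff)
      ultimately show ?case
        using uniform_sample.prob_max_gcd_le_approx[OF sample elim(2,1)]
        by (simp add: C_def S_def)
    qed
    ultimately have "(\<lambda>m. prb t m - exp (- (C m * S m))) \<longlonglongrightarrow> 0"
      by (rule Lim_null_comparison[rotated])
    from tendsto_add[OF this poisson] show ?thesis by simp
  qed
  \<comment> \<open>The limit distribution function vanishes on \<open>t \<le> 0\<close>, and a maximal gcd of \<open>0\<close> would force \<open>X 1 = 0\<close>.\<close>
  have prb_nonpos: "\<forall>\<^sub>F m in sequentially. prb t m = 0" if t: "t \<le> 0" for t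
    using eventually_ge_at_top[of 2]
  proof eventually_elim
    case (elim m)
    interpret uniform_sample "P (n m)" "X (n m)" "n m" by (rule sample)
    have "prb t m \<le> prob (X (n m) 1 -` {0} \<inter> space (P (n m)))" unfolding prb_def
    proof (rule finite_measure_mono)
      show "X (n m) 1 -` {0} \<inter> space (P (n m)) \<in> events" by (intro measurable_sets[OF X_measurable]) auto
      show "{\<omega> \<in> space (P (n m)). scaled_max_gcd (X (n m)) m \<omega> \<le> t} \<subseteq> X (n m) 1 -` {0} \<inter> space (P (n m))"
      proof
        fix \<omega> assume \<omega>: "\<omega> \<in> {\<omega> \<in> space (P (n m)). scaled_max_gcd (X (n m)) m \<omega> \<le> t}"
        hence "real (max_gcd (X (n m)) m \<omega>) / real (m choose 2) \<le> 0"
          using t by (simp add: scaled_max_gcd_def)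
        hence "max_gcd (X (n m)) m \<omega> \<le> 0" using choose_2_pos[OF elim] by (simp add: divide_le_0_iff)
        moreover have "(1, 2) \<in> pairs_upto m" using elim by (simp add: pairs_upto_def)
        ultimately have "gcd (X (n m) 1 \<omega>) (X (n m) 2 \<omega>) = 0"
          unfolding max_gcd_le_iff[OF elim] by force
        thus "\<omega> \<in> X (n m) 1 -` {0} \<inter> space (P (n m))" using \<omega> by simp
      qed
    qed
    also have "\<dots> = 0" by (subst prob_X_in) auto
    finally show "prb t m = 0" by (simp add: prb_def antisym)
  qed
  have "weak_conv_m (\<lambda>m. distr (P (n m)) borel (scaled_max_gcd (X (n m)) m)) (frechet_distribution (1 / zeta 2))"
    unfolding weak_conv_m_def weak_conv_def
  proof (intro allI impI)
    fix t :: real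
    have z: "1 / zeta 2 > 0" using zeta_2_ge_1 by simp
    have "\<forall>\<^sub>F m in sequentially. prb t m = cdf (distr (P (n m)) borel (scaled_max_gcd (X (n m)) m)) t"
      using eventually_ge_at_top[of 2]
    proof eventually_elim
      case (elim m)
      interpret uniform_sample "P (n m)" "X (n m)" "n m" by (rule sample)
      have [measurable]: "max_gcd (X (n m)) m \<in> measurable (P (n m)) (count_space UNIV)"
        by (intro measurable_max_gcd elim X_measurable)
      have "scaled_max_gcd (X (n m)) m \<in> borel_measurable (P (n m))"
        unfolding scaled_max_gcd_def by measurable
      thus ?case by (simp add: cdf_def measure_distr prb_def vimage_def Int_def conj_commute)
    qed
    moreover have "prb t \<longlonglongrightarrow> cdf (frechet_distribution (1 / zeta 2)) t"
    proof (cases "t > 0")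
      case True
      thus ?thesis using prb_lim[OF True] by (simp add: cdf_frechet[OF z] frechet_cdf_def field_simps)
    next
      case False
      thus ?thesis using tendsto_eventually[OF prb_nonpos[of t]]
        by (simp add: cdf_frechet[OF z] frechet_cdf_def)
    qed
    ultimately show "(\<lambda>m. cdf (distr (P (n m)) borel (scaled_max_gcd (X (n m)) m)) t)
        \<longlonglongrightarrow> cdf (frechet_distribution (1 / zeta 2)) t"
      by (rule Lim_transform_eventually[rotated])
  qed
  thus ?thesis using prb_lim by (simp add: prb_def[abs_def])
qed

end
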